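(* Let $H, W, b$ be positive integers, $\alpha\in(0,1]$, and $k=\lfloor \alpha\cdot HW\rfloor$. Let $Y, Y_N, X, Z, E, M$ be random variables on a common probability space, where $X$ is an agent's observation, $Z$ an intermediate feature, $E$ the information-aware feature, $M$ a sparse mask that is a random $H\times W$ array with at most $k$ nonzero entries and all entries in $\{0,1,\dots,2^b-1\}$, $Y$ the perceptual target, and $Y_N$ task-irrelevant noise. Assume that $Y$ and $Y_N$ are independent and that $(Y,Y_N)\rightarrow X\rightarrow Z\rightarrow (E,M)$ is a Markov chain. Then $$I(E,M;Y_N)\;\le\; I(E,M;Z)-I(E,M;Y).$$ Furthermore, $$I(E,M;Z)\;\le\; I(E;Z)+H(M)\;\le\; I(E;Z)+\log\binom{HW}{k}+k\,b.$$
   Context: $I(\cdot\,;\cdot)$ denotes mutual information and $H(\cdot)$, applied to a discrete random variable, denotes Shannon entropy; $I(E,M;\cdot)$ is the mutual information between the pair $(E,M)$ and the other variable. All information quantities are measured in bits, i.e. $\log=\log_2$. In $HW$ the letter $H$ is the integer height of the spatial grid (not the entropy). The inequality involving the difference $I(E,M;Z)-I(E,M;Y)$ is asserted when this difference is well defined, i.e. not of the form $\infty-\infty$. Setting: $Z\in\mathbb{R}^{C\times H\times W}$ and $E\in\mathbb{R}^{D}$ for positive integers $C, D$. The pair $(E,M)$ is the message unit transmitted by the agent. The mask $M$ is obtained from a real-valued $H\times W$ array by keeping only $k=\lfloor\alpha\cdot HW\rfloor$ positions (the others are set to $0$), where $\alpha$ is the retention ratio, and then quantizing the kept values uniformly with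 bit-width $b$, so that each entry takes values in $\{0,1,\dots,2^b-1\}$. The Markov chain $(Y,Y_N)\rightarrow X\rightarrow Z\rightarrow(E,M)$ means that each variable is conditionally independent of all earlier ones given its immediate predecessor. *)

theory Defs
  imports "HOL-Probability.Probability"
begin

text \<open>
  The library's \<^const>\<open>KL_divergence\<close> is real-valued: it is the Bochner integral of
  \<^term>\<open>entropy_density b M N\<close> with respect to \<^term>\<open>N\<close>, hence \<open>0\<close> when that function is not
  integrable, and it is meaningless when \<^term>\<open>N\<close> is not absolutely continuous with respect to
  \<^term>\<open>M\<close>. For probability measures with \<^term>\<open>N\<close> absolutely continuous with respect to
  \<^term>\<open>M\<close> and \<^prop>\<open>1 < b\<close>, the negative part of the density is always integrable, because
  \<open>t * log b t\<close> is bounded below on \<open>t \<ge> 0\<close>. So non-integrability means exactly that the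
  divergence is \<open>\<infinity>\<close>.
\<close>

definition ext_KL_divergence :: "real \<Rightarrow> 'a measure \<Rightarrow> 'a measure \<Rightarrow> ereal" where
  "ext_KL_divergence b M N =
     (if absolutely_continuous M N \<and> integrable N (entropy_density b M N)
      then ereal (KL_divergence b M N) else \<infinity>)"

definition ext_mutual_information ::
  "'a measure \<Rightarrow> real \<Rightarrow> 's measure \<Rightarrow> 't measure \<Rightarrow> ('a \<Rightarrow> 's) \<Rightarrow> ('a \<Rightarrow> 't) \<Rightarrow> ereal" where
  "ext_mutual_information P b S T X Y =
     ext_KL_divergence b (distr P S X \<Otimes>\<^sub>M distr P T Y)
       (distr P (S \<Otimes>\<^sub>M T) (\<lambda>\<omega>. (X \<omega>, Y \<omega>)))"

text \<open>
  The library's \<^const>\<open>prob_space.indep_var\<close> forces both variables to have the same value type;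
  this version does not.
\<close>

definition indep_rv ::
  "'a measure \<Rightarrow> 's measure \<Rightarrow> ('a \<Rightarrow> 's) \<Rightarrow> 't measure \<Rightarrow> ('a \<Rightarrow> 't) \<Rightarrow> bool" where
  "indep_rv P S X T Y \<longleftrightarrow>
     X \<in> measurable P S \<and> Y \<in> measurable P T \<and>
     prob_space.indep_set P (sets (vimage_algebra (space P) X S))
                            (sets (vimage_algebra (space P) Y T))"

definition cond_prob_given ::
  "'a measure \<Rightarrow> 'r measure \<Rightarrow> ('a \<Rightarrow> 'r) \<Rightarrow> 'a set \<Rightarrow> 'a \<Rightarrow> real" where
  "cond_prob_given P R V A =
     real_cond_exp P (vimage_algebra (space P) V R) (indicator A)"

text \<open>\<open>X\<close> and \<open>Y\<close> are conditionally independent given \<open>V\<close>.\<close>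

definition cond_indep_rv ::
  "'a measure \<Rightarrow> 's measure \<Rightarrow> ('a \<Rightarrow> 's) \<Rightarrow> 't measure \<Rightarrow> ('a \<Rightarrow> 't) \<Rightarrow>
   'r measure \<Rightarrow> ('a \<Rightarrow> 'r) \<Rightarrow> bool" where
  "cond_indep_rv P S X T Y R V \<longleftrightarrow>
     X \<in> measurable P S \<and> Y \<in> measurable P T \<and> V \<in> measurable P R \<and>
     (\<forall>A\<in>sets S. \<forall>B\<in>sets T. AE \<omega> in P.
        cond_prob_given P R V (X -` A \<inter> Y -` B \<inter> space P) \<omega> =
        cond_prob_given P R V (X -` A \<inter> space P) \<omega> *
        cond_prob_given P R V (Y -` B \<inter> space P) \<omega>)"

text \<open>
  The Markov chain \<open>T \<rightarrow> X \<rightarrow> Z \<rightarrow> U\<close>: each variable is conditionally independent of all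
  earlier ones given its immediate predecessor (for \<open>X\<close> there is nothing to require).
\<close>

definition markov_chain4 ::
  "'a measure \<Rightarrow> 't measure \<Rightarrow> ('a \<Rightarrow> 't) \<Rightarrow> 'x measure \<Rightarrow> ('a \<Rightarrow> 'x) \<Rightarrow>
   'z measure \<Rightarrow> ('a \<Rightarrow> 'z) \<Rightarrow> 'u measure \<Rightarrow> ('a \<Rightarrow> 'u) \<Rightarrow> bool" where
  "markov_chain4 P ST T SX X SZ Z SU U \<longleftrightarrow>
     cond_indep_rv P SZ Z ST T SX X \<and>
     cond_indep_rv P SU U (ST \<Otimes>\<^sub>M SX) (\<lambda>\<omega>. (T \<omega>, X \<omega>)) SZ Z"

end

theory Submission
  imports Defs
begin

text \<open>
  Everything rests on Gibbs' inequality: among all \<open>g\<close> whose integral against the product of the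
  marginals is at most 1, the expectation of \<open>log g\<close> is largest for the density of the joint law.

  For the first claim, write \<open>U = (E, M)\<close> and \<open>T = (Y, Y\<^sub>N, X)\<close>. By the Markov property, a density
  \<open>f(u, z)\<close> of the law of \<open>(U, Z)\<close> is also a density of the law of \<open>(U, (T, Z))\<close>. If \<open>f\<^sub>1(u, y)\<close> and
  \<open>f\<^sub>2(u, n)\<close> are the densities for \<open>(U, Y)\<close> and \<open>(U, Y\<^sub>N)\<close>, independence of \<open>Y\<close> and \<open>Y\<^sub>N\<close> gives
  \<open>g = f\<^sub>1 f\<^sub>2\<close> integral 1, so \<open>I(U; Y) + I(U; Y\<^sub>N) \<le> I(U; Z)\<close>.

  For the second claim, the density for \<open>((E, M), Z)\<close> is compared with that for \<open>(E, Z)\<close> divided by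
  the probability of the value of \<open>M\<close>. The third is the bound of an entropy by the logarithm of
  the size of the support, which is then counted.
\<close>

section \<open>Densities and Gibbs' inequality\<close>

text \<open>Radon-Nikodym derivatives are unique \<open>M\<close>-almost everywhere, hence
  \<open>N\<close>-almost everywhere by absolute continuity, so any version \<open>h\<close> may
  replace the one inside \<open>entropy_density\<close>.\<close>

lemma (in sigma_finite_measure) ext_KL_divergence_density:
  fixes h :: "'a \<Rightarrow> real"
  assumes h[measurable]: "h \<in> borel_measurable M" and h0: "\<And>x. 0 \<le> h x"
    and N: "N = density M (\<lambda>x. ennreal (h x))"
  shows "ext_KL_divergence b M N =
    (if integrable N (\<lambda>x. log b (h x)) then ereal (\<integral>x. log b (h x) \<partial>N) else \<infinity>)"
proof -
  have ac: "absolutely_continuous M N"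
    unfolding N by (rule absolutely_continuousI_density) measurable
  have sets[measurable_cong]: "sets N = sets M" by (simp add: N)
  have "AE x in M. ennreal (h x) = RN_deriv M N x"
    by (rule RN_deriv_unique) (simp_all add: N)
  then have "AE x in N. ennreal (h x) = RN_deriv M N x"
    by (rule absolutely_continuous_AE[OF sets ac])
  then have eq: "AE x in N. entropy_density b M N x = log b (h x)"
    by eventually_elim (metis comp_apply enn2real_ennreal entropy_density_def h0)
  have "integrable N (entropy_density b M N) \<longleftrightarrow> integrable N (\<lambda>x. log b (h x))"
    using eq by (intro integrable_cong_AE) (auto simp: sets cong: measurable_cong_sets)
  moreover have "KL_divergence b M N = (\<integral>x. log b (h x) \<partial>N)"
    unfolding KL_divergence_def using eq by (intro integral_cong_AE) auto
  ultimately show ?thesis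
    using ac by (simp add: ext_KL_divergence_def)
qed

lemma (in sigma_finite_measure) absolutely_continuous_obtain_real_density:
  assumes N: "finite_measure N" "absolutely_continuous M N" "sets N = sets M"
  obtains h :: "'a \<Rightarrow> real" where "h \<in> borel_measurable M" "\<And>x. 0 \<le> h x"
    "N = density M (\<lambda>x. ennreal (h x))"
proof -
  obtain D where D: "D \<in> borel_measurable M" "AE x in M. RN_deriv M N x = ennreal (D x)"
    "\<And>x. 0 \<le> D x"
    using real_RN_deriv[OF N] by metis
  have "N = density M (RN_deriv M N)"
    using density_RN_deriv[OF N(2,3)] by simp
  also have "\<dots> = density M (\<lambda>x. ennreal (D x))"
    using D by (intro density_cong) auto
  finally show ?thesis using D that by blast
qed

text \<open>This is \<open>ln t \<le> t - 1\<close> at \<open>t = g / h\<close>, arranged so that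
  taking expectations yields Gibbs' inequality.\<close>

lemma log_le_log_add:
  fixes g h b :: real
  assumes "1 < b" "0 < g" "0 < h"
  shows "log b g \<le> log b h + (g / h - 1) / ln b"
proof -
  have "ln g - ln h \<le> g / h - 1"
    using assms by (metis ln_div ln_le_minus_one zero_less_divide_iff less_numeral_extra(3))
  then have "(ln g - ln h) / ln b \<le> (g / h - 1) / ln b"
    using assms by (intro divide_right_mono) auto
  then show ?thesis by (simp add: log_def diff_divide_distrib)
qed

lemma integrable_of_nn_integral_le_1:
  fixes f :: "'a \<Rightarrow> real"
  assumes "f \<in> borel_measurable M" "AE x in M. 0 \<le> f x" "(\<integral>\<^sup>+x. ennreal (f x) \<partial>M) \<le> 1"
  shows "integrable M f" "(\<integral>x. f x \<partial>M) \<le> 1"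
proof -
  show "integrable M f"
    using assms by (intro integrableI_nonneg) (auto intro: le_less_trans)
  then have "ennreal (\<integral>x. f x \<partial>M) \<le> ennreal 1"
    using assms by (subst nn_integral_eq_integral[symmetric]) auto
  then show "(\<integral>x. f x \<partial>M) \<le> 1" by (subst (asm) ennreal_le_iff) auto
qed

text \<open>\<open>h\<close> and \<open>g\<close> stand for the densities of the given law and of a competing subprobability with respect
  to a common reference measure, composed with the random variable; the last assumption then says
  that the competitor has mass at most 1.\<close>

lemma (in prob_space) gibbs_inequality:
  fixes g h :: "'a \<Rightarrow> real"
  assumes b: "1 < b"
    and [measurable]: "g \<in> borel_measurable M" "h \<in> borel_measurable M"
    and pos: "AE x in M. 0 < g x" "AE x in M. 0 < h x"
    and int: "integrable M (\<lambda>x. log b (h x))" "integrable M (\<lambda>x. log b (g x))"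
    and le: "(\<integral>\<^sup>+x. ennreal (g x / h x) \<partial>M) \<le> 1"
  shows "(\<integral>x. log b (g x) \<partial>M) \<le> (\<integral>x. log b (h x) \<partial>M)"
proof -
  have gh: "integrable M (\<lambda>x. g x / h x)" "(\<integral>x. g x / h x \<partial>M) \<le> 1"
    using pos le by (auto intro!: integrable_of_nn_integral_le_1 elim: AE_mp)
  have "(\<integral>x. log b (g x) \<partial>M) \<le> (\<integral>x. log b (h x) + (g x / h x - 1) / ln b \<partial>M)"
  proof (rule integral_mono_AE)
    show "AE x in M. log b (g x) \<le> log b (h x) + (g x / h x - 1) / ln b"
      using pos by eventually_elim (rule log_le_log_add[OF b])
  qed (use int gh in auto)
  also have "\<dots> = (\<integral>x. log b (h x) \<partial>M) + ((\<integral>x. g x / h x \<partial>M) - 1) / ln b"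
    using int gh by (simp add: prob_space)
  also have "\<dots> \<le> (\<integral>x. log b (h x) \<partial>M)"
    using gh b by (simp add: divide_nonpos_pos)
  finally show ?thesis .
qed

text \<open>The logarithm of \<open>g\<close> is squeezed between two integrable functions: the
  ratio \<open>g / h\<close> bounds it from above, \<open>1 / g\<close> from below. Since
  non-integrability encodes the value \<infinity>, this is how finiteness passes from one
  information to another.\<close>

lemma (in prob_space) integrable_log_of_le:
  fixes g h :: "'a \<Rightarrow> real"
  assumes b: "1 < b"
    and [measurable]: "g \<in> borel_measurable M" "h \<in> borel_measurable M"
    and pos: "AE x in M. 0 < g x" "AE x in M. 0 < h x"
    and int: "integrable M (\<lambda>x. log b (h x))"
    and le: "(\<integral>\<^sup>+x. ennreal (g x / h x) \<partial>M) \<le> 1" "(\<integral>\<^sup>+x. ennreal (1 / g x) \<partial>M) \<le> 1"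
  shows "integrable M (\<lambda>x. log b (g x))"
proof -
  have gh: "integrable M (\<lambda>x. g x / h x)" "integrable M (\<lambda>x. 1 / g x)"
    using pos le by (auto intro!: integrable_of_nn_integral_le_1 elim: AE_mp)
  show ?thesis
  proof (rule Bochner_Integration.integrable_bound)
    show "integrable M (\<lambda>x. \<bar>log b (h x) + (g x / h x - 1) / ln b\<bar> + \<bar>(1 / g x - 1) / ln b\<bar>)"
      using gh int by auto
    show "AE x in M. norm (log b (g x)) \<le>
        norm (\<bar>log b (h x) + (g x / h x - 1) / ln b\<bar> + \<bar>(1 / g x - 1) / ln b\<bar>)"
      using pos
    proof eventually_elim
      case (elim x)
      have "log b (g x) \<le> log b (h x) + (g x / h x - 1) / ln b"
        using log_le_log_add[OF b elim] .
      \<comment> \<open>The same tangent bound, with \<open>1 / g x\<close> against the constant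
        1.\<close>
      moreover have "- log b (g x) \<le> (1 / g x - 1) / ln b"
        using log_le_log_add[OF b, of "1 / g x" 1] elim b by (simp add: log_divide)
      ultimately show ?case by (auto simp: abs_real_def)
    qed
  qed measurable
qed

section \<open>Dependence densities\<close>

text \<open>The logarithm of \<open>f (X, Y)\<close> is the pointwise information of the pair.
  Nonnegativity is demanded everywhere, not just almost everywhere, to spare side conditions with
  \<open>ennreal\<close>.\<close>

definition dependence_density ::
  "'a measure \<Rightarrow> 's measure \<Rightarrow> 't measure \<Rightarrow> ('a \<Rightarrow> 's) \<Rightarrow> ('a \<Rightarrow> 't) \<Rightarrow> ('s \<times> 't \<Rightarrow> real) \<Rightarrow> bool"
where
  "dependence_density P S T X Y f \<longleftrightarrow>
     f \<in> borel_measurable (S \<Otimes>\<^sub>M T) \<and> (\<forall>x. 0 \<le> f x) \<and>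
     distr P (S \<Otimes>\<^sub>M T) (\<lambda>\<omega>. (X \<omega>, Y \<omega>)) =
       density (distr P S X \<Otimes>\<^sub>M distr P T Y) (\<lambda>x. ennreal (f x))"

lemma dependence_densityD:
  assumes "dependence_density P S T X Y f"
  shows "f \<in> borel_measurable (S \<Otimes>\<^sub>M T)" "\<And>x. 0 \<le> f x"
    "distr P (S \<Otimes>\<^sub>M T) (\<lambda>\<omega>. (X \<omega>, Y \<omega>)) =
       density (distr P S X \<Otimes>\<^sub>M distr P T Y) (\<lambda>x. ennreal (f x))"
  using assms by (auto simp: dependence_density_def)

context prob_space
begin

context
  fixes S :: "'s measure" and T :: "'t measure" and X Y
  assumes X[measurable]: "X \<in> measurable M S" and Y[measurable]: "Y \<in> measurable M T"
begin

interpretation PX: prob_space "distr M S X" by (rule prob_space_distr) (rule X)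
interpretation PY: prob_space "distr M T Y" by (rule prob_space_distr) (rule Y)
interpretation PXY: pair_prob_space "distr M S X" "distr M T Y" ..

text \<open>Integrals against the joint law are pulled back to \<open>M\<close>. Informations of
  different pairs thus become expectations over one probability space, where Gibbs' inequality can
  compare them.\<close>

lemma ext_mutual_information_dependence_density:
  assumes "dependence_density M S T X Y f"
  shows "ext_mutual_information M b S T X Y =
    (if integrable M (\<lambda>\<omega>. log b (f (X \<omega>, Y \<omega>)))
     then ereal (\<integral>\<omega>. log b (f (X \<omega>, Y \<omega>)) \<partial>M) else \<infinity>)"
proof -
  note [measurable] = dependence_densityD(1)[OF assms]
  show ?thesis
    unfolding ext_mutual_information_def
    apply (subst PXY.ext_KL_divergence_density[OF _ dependence_densityD(2,3)[OF assms]])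
     apply measurable
    by (simp add: integrable_distr_eq integral_distr)
qed

lemma dependence_density_exists:
  assumes "absolutely_continuous (distr M S X \<Otimes>\<^sub>M distr M T Y)
    (distr M (S \<Otimes>\<^sub>M T) (\<lambda>\<omega>. (X \<omega>, Y \<omega>)))"
  shows "\<exists>f. dependence_density M S T X Y f"
proof -
  have "finite_measure (distr M (S \<Otimes>\<^sub>M T) (\<lambda>\<omega>. (X \<omega>, Y \<omega>)))"
    by (intro finite_measure_distr) measurable
  from PXY.absolutely_continuous_obtain_real_density[OF this assms]
  obtain h :: "'s \<times> 't \<Rightarrow> real" where "h \<in> borel_measurable (distr M S X \<Otimes>\<^sub>M distr M T Y)"
    "\<And>x. 0 \<le> h x"
    "distr M (S \<Otimes>\<^sub>M T) (\<lambda>\<omega>. (X \<omega>, Y \<omega>)) = density (distr M S X \<Otimes>\<^sub>M distr M T Y) (\<lambda>x. ennreal (h x))"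
    by (auto cong: sets_pair_measure_cong)
  then show ?thesis
    by (auto simp: dependence_density_def cong: measurable_cong_sets sets_pair_measure_cong)
qed

text \<open>A finite value rules out the default \<infinity> that covers joint laws without absolute
  continuity.\<close>

lemma dependence_density_exists_of_finite_ext_mutual_information:
  assumes "ext_mutual_information M b S T X Y \<noteq> \<infinity>"
  shows "\<exists>f. dependence_density M S T X Y f"
  using assms by (intro dependence_density_exists)
    (auto simp: ext_mutual_information_def ext_KL_divergence_def split: if_splits)

context
  fixes f assumes dd: "dependence_density M S T X Y f"
begin

lemma nn_integral_dependence_density:
  assumes [measurable]: "G \<in> borel_measurable (S \<Otimes>\<^sub>M T)"
  shows "(\<integral>\<^sup>+\<omega>. G (X \<omega>, Y \<omega>) \<partial>M) =
    (\<integral>\<^sup>+x. ennreal (f x) * G x \<partial>(distr M S X \<Otimes>\<^sub>M distr M T Y))"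
proof -
  note [measurable] = dependence_densityD(1)[OF dd]
  have "(\<integral>\<^sup>+\<omega>. G (X \<omega>, Y \<omega>) \<partial>M) = (\<integral>\<^sup>+x. G x \<partial>distr M (S \<Otimes>\<^sub>M T) (\<lambda>\<omega>. (X \<omega>, Y \<omega>)))"
    by (subst nn_integral_distr) auto
  also have "\<dots> = (\<integral>\<^sup>+x. ennreal (f x) * G x \<partial>(distr M S X \<Otimes>\<^sub>M distr M T Y))"
    unfolding dependence_densityD(3)[OF dd] by (subst nn_integral_density) auto
  finally show ?thesis .
qed

lemma AE_dependence_density_pos: "AE \<omega> in M. 0 < f (X \<omega>, Y \<omega>)"
proof -
  note [measurable] = dependence_densityD(1)[OF dd]
  have "AE x in distr M (S \<Otimes>\<^sub>M T) (\<lambda>\<omega>. (X \<omega>, Y \<omega>)). 0 < f x"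
    unfolding dependence_densityD(3)[OF dd] by (subst AE_density) auto
  then show ?thesis by (subst (asm) AE_distr_iff) auto
qed

text \<open>The factor \<open>f\<close> from the change of measure cancels the denominator where
  \<open>f\<close> is positive. Where \<open>f\<close> vanishes, division by zero gives 0 and the
  mass of \<open>G\<close> is lost, hence only an inequality.\<close>

lemma nn_integral_divide_dependence_density_le:
  fixes G :: "'s \<times> 't \<Rightarrow> real"
  assumes [measurable]: "G \<in> borel_measurable (S \<Otimes>\<^sub>M T)" and G: "\<And>x. 0 \<le> G x"
  shows "(\<integral>\<^sup>+\<omega>. ennreal (G (X \<omega>, Y \<omega>) / f (X \<omega>, Y \<omega>)) \<partial>M) \<le>
    (\<integral>\<^sup>+x. ennreal (G x) \<partial>(distr M S X \<Otimes>\<^sub>M distr M T Y))"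
proof -
  note [measurable] = dependence_densityD(1)[OF dd]
  have "ennreal (f x) * ennreal (G x / f x) \<le> ennreal (G x)" for x
    using dependence_densityD(2)[OF dd, of x] G[of x]
    by (cases "f x = 0") (auto simp: ennreal_mult[symmetric])
  then show ?thesis
    by (subst nn_integral_dependence_density[of "\<lambda>x. ennreal (G x / f x)"]) (auto intro!: nn_integral_mono)
qed

lemma nn_integral_inverse_dependence_density_le:
  "(\<integral>\<^sup>+\<omega>. ennreal (1 / f (X \<omega>, Y \<omega>)) \<partial>M) \<le> 1"
  using nn_integral_divide_dependence_density_le[of "\<lambda>_. 1"] PXY.emeasure_space_1 by simp

text \<open>The first marginal of the joint law is the law of \<open>X\<close>, so the slice
  integral is a density of that law against itself, and uniqueness of densities forces it to be 1.
  In effect each slice is a conditional density of \<open>Y\<close> given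
  \<open>X = x\<close>.\<close>

lemma nn_integral_dependence_density_slice:
  "AE x in distr M S X. (\<integral>\<^sup>+y. ennreal (f (x, y)) \<partial>distr M T Y) = 1"
proof -
  note [measurable] = dependence_densityD(1)[OF dd]
  show ?thesis
  proof (rule PX.density_unique)
  show "density (distr M S X) (\<lambda>x. \<integral>\<^sup>+y. ennreal (f (x, y)) \<partial>distr M T Y) = density (distr M S X) (\<lambda>_. 1)"
  proof (rule measure_eqI)
    fix A assume "A \<in> sets (density (distr M S X) (\<lambda>x. \<integral>\<^sup>+y. ennreal (f (x, y)) \<partial>distr M T Y))"
    then have [measurable]: "A \<in> sets S" by simp
    have "emeasure (density (distr M S X) (\<lambda>x. \<integral>\<^sup>+y. ennreal (f (x, y)) \<partial>distr M T Y)) A =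
      (\<integral>\<^sup>+x. \<integral>\<^sup>+y. ennreal (f (x, y)) * indicator A x \<partial>distr M T Y \<partial>distr M S X)"
      by (subst emeasure_density) (auto intro!: nn_integral_cong nn_integral_multc[symmetric])
    also have "\<dots> = (\<integral>\<^sup>+x. ennreal (f x) * indicator A (fst x) \<partial>(distr M S X \<Otimes>\<^sub>M distr M T Y))"
      by (subst PY.nn_integral_fst[symmetric]) auto
    also have "\<dots> = (\<integral>\<^sup>+\<omega>. indicator A (X \<omega>) \<partial>M)"
      by (subst nn_integral_dependence_density[symmetric]) auto
    also have "\<dots> = (\<integral>\<^sup>+x. indicator A x \<partial>distr M S X)"
      by (subst nn_integral_distr) auto
    also have "\<dots> = emeasure (density (distr M S X) (\<lambda>_. 1)) A"
      by (subst emeasure_density) auto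
    finally show "emeasure (density (distr M S X) (\<lambda>x. \<integral>\<^sup>+y. ennreal (f (x, y)) \<partial>distr M T Y)) A =
        emeasure (density (distr M S X) (\<lambda>_. 1)) A" .
  qed simp
  qed auto
qed

lemma nn_integral_dependence_density_eq_1:
  "(\<integral>\<^sup>+x. ennreal (f x) \<partial>(distr M S X \<Otimes>\<^sub>M distr M T Y)) = 1"
  using nn_integral_dependence_density[of "\<lambda>_. 1"] emeasure_space_1 by simp

end

end

end

section \<open>Superadditivity over independent variables\<close>

lemma pair_measure_distr_snd:
  assumes a[measurable]: "a \<in> measurable N T" and "prob_space N"
  shows "M \<Otimes>\<^sub>M distr N T a = distr (M \<Otimes>\<^sub>M N) (M \<Otimes>\<^sub>M T) (\<lambda>(x, y). (x, a y))"
proof -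
  interpret N: prob_space N by fact
  have "distr M M (\<lambda>x. x) \<Otimes>\<^sub>M distr N T a = distr (M \<Otimes>\<^sub>M N) (M \<Otimes>\<^sub>M T) (\<lambda>(x, y). (x, a y))"
    by (rule pair_measure_distr) (auto intro!: prob_space_imp_sigma_finite N.prob_space_distr)
  then show ?thesis by simp
qed

context prob_space
begin

context
  fixes SU :: "'u measure" and SV :: "'v measure" and U V f
  assumes U[measurable]: "U \<in> measurable M SU" and V[measurable]: "V \<in> measurable M SV"
    and dd: "dependence_density M SU SV U V f"
begin

lemma pair_measure_distr_image:
  assumes [measurable]: "a \<in> measurable SV SY"
  shows "distr M SU U \<Otimes>\<^sub>M distr M SY (\<lambda>\<omega>. a (V \<omega>)) =
    distr (distr M SU U \<Otimes>\<^sub>M distr M SV V) (SU \<Otimes>\<^sub>M SY) (\<lambda>(x, y). (x, a y))"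
proof -
  have "distr M SY (\<lambda>\<omega>. a (V \<omega>)) = distr (distr M SV V) SY a"
    by (subst distr_distr) (auto simp: comp_def)
  moreover have "distr M SU U \<Otimes>\<^sub>M distr (distr M SV V) SY a =
      distr (distr M SU U \<Otimes>\<^sub>M distr M SV V) (distr M SU U \<Otimes>\<^sub>M SY) (\<lambda>(x, y). (x, a y))"
    by (rule pair_measure_distr_snd) (auto intro!: prob_space_distr)
  moreover have "\<dots> = distr (distr M SU U \<Otimes>\<^sub>M distr M SV V) (SU \<Otimes>\<^sub>M SY) (\<lambda>(x, y). (x, a y))"
    by (rule distr_cong) (simp_all cong: sets_pair_measure_cong)
  ultimately show ?thesis by (simp only:)
qed

text \<open>A competitor that sees \<open>V\<close> only through \<open>a\<close> is integrated
  against an image of the product of the laws of \<open>U\<close> and \<open>V\<close>, so its mass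
  can be computed on the smaller space.\<close>

lemma nn_integral_image_divide_dependence_density_le:
  fixes G :: "'u \<times> 'y \<Rightarrow> real"
  assumes a[measurable]: "a \<in> measurable SV SY"
    and [measurable]: "G \<in> borel_measurable (SU \<Otimes>\<^sub>M SY)" and G: "\<And>x. 0 \<le> G x"
  shows "(\<integral>\<^sup>+\<omega>. ennreal (G (U \<omega>, a (V \<omega>)) / f (U \<omega>, V \<omega>)) \<partial>M) \<le>
    (\<integral>\<^sup>+x. ennreal (G x) \<partial>(distr M SU U \<Otimes>\<^sub>M distr M SY (\<lambda>\<omega>. a (V \<omega>))))"
proof -
  note [measurable] = dependence_densityD(1)[OF dd]
  have "(\<integral>\<^sup>+\<omega>. ennreal (G (U \<omega>, a (V \<omega>)) / f (U \<omega>, V \<omega>)) \<partial>M) \<le>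
      (\<integral>\<^sup>+x. ennreal (G (fst x, a (snd x))) \<partial>(distr M SU U \<Otimes>\<^sub>M distr M SV V))"
    using nn_integral_divide_dependence_density_le[OF U V dd, of "\<lambda>x. G (fst x, a (snd x))"] G
    by simp
  also have "\<dots> = (\<integral>\<^sup>+x. ennreal (G x) \<partial>(distr M SU U \<Otimes>\<^sub>M distr M SY (\<lambda>\<omega>. a (V \<omega>))))"
    unfolding pair_measure_distr_image[OF a] by (subst nn_integral_distr) (auto simp: split_def)
  finally show ?thesis .
qed

text \<open>Null sets of the smaller product pull back to null sets of the larger one, and these are
  null for the joint law, which has a density there.\<close>

lemma dependence_density_image_exists:
  assumes a[measurable]: "a \<in> measurable SV SY"
  shows "\<exists>g. dependence_density M SU SY U (\<lambda>\<omega>. a (V \<omega>)) g"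
proof (rule dependence_density_exists)
  note [measurable] = dependence_densityD(1)[OF dd]
  show "absolutely_continuous (distr M SU U \<Otimes>\<^sub>M distr M SY (\<lambda>\<omega>. a (V \<omega>)))
      (distr M (SU \<Otimes>\<^sub>M SY) (\<lambda>\<omega>. (U \<omega>, a (V \<omega>))))"
    unfolding absolutely_continuous_def
  proof
    fix A assume "A \<in> null_sets (distr M SU U \<Otimes>\<^sub>M distr M SY (\<lambda>\<omega>. a (V \<omega>)))"
    then have A[measurable]: "A \<in> sets (SU \<Otimes>\<^sub>M SY)"
      and "AE x in distr (distr M SU U \<Otimes>\<^sub>M distr M SV V) (SU \<Otimes>\<^sub>M SY) (\<lambda>(x, y). (x, a y)). x \<notin> A"
      unfolding pair_measure_distr_image[OF a] by (simp_all add: null_sets_def AE_not_in)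
    then have "AE x in distr M SU U \<Otimes>\<^sub>M distr M SV V. (fst x, a (snd x)) \<notin> A"
      by (subst (asm) AE_distr_iff) (auto simp: split_def)
    then have "AE x in density (distr M SU U \<Otimes>\<^sub>M distr M SV V) (\<lambda>x. ennreal (f x)). (fst x, a (snd x)) \<notin> A"
      by (subst AE_density) auto
    then have "AE \<omega> in M. (U \<omega>, a (V \<omega>)) \<notin> A"
      unfolding dependence_densityD(3)[OF dd, symmetric] by (subst (asm) AE_distr_iff) auto
    then show "A \<in> null_sets (distr M (SU \<Otimes>\<^sub>M SY) (\<lambda>\<omega>. (U \<omega>, a (V \<omega>))))"
      by (subst null_sets_distr_iff) (auto simp: AE_iff_null_sets vimage_def Int_def conj_commute)
  qed
qed measurable

text \<open>A qualitative data processing inequality. The density \<open>g\<close> is itself a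
  competitor of mass 1, which bounds the mean of its ratio to \<open>f\<close>; the bound on the
  inverse holds for every dependence density.\<close>

lemma integrable_log_dependence_density_image:
  assumes b: "1 < b" and a[measurable]: "a \<in> measurable SV SY"
    and int: "integrable M (\<lambda>\<omega>. log b (f (U \<omega>, V \<omega>)))"
    and g: "dependence_density M SU SY U (\<lambda>\<omega>. a (V \<omega>)) g"
  shows "integrable M (\<lambda>\<omega>. log b (g (U \<omega>, a (V \<omega>))))"
proof (rule integrable_log_of_le[OF b _ _ _ _ int])
  note [measurable] = dependence_densityD(1)[OF dd] dependence_densityD(1)[OF g]
  have Y[measurable]: "(\<lambda>\<omega>. a (V \<omega>)) \<in> measurable M SY" by measurable
  show "(\<lambda>\<omega>. g (U \<omega>, a (V \<omega>))) \<in> borel_measurable M" "(\<lambda>\<omega>. f (U \<omega>, V \<omega>)) \<in> borel_measurable M"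
    by measurable
  show "AE x in M. 0 < f (U x, V x)" by (rule AE_dependence_density_pos[OF U V dd])
  show "AE x in M. 0 < g (U x, a (V x))" by (rule AE_dependence_density_pos[OF U Y g])
  show "(\<integral>\<^sup>+\<omega>. ennreal (g (U \<omega>, a (V \<omega>)) / f (U \<omega>, V \<omega>)) \<partial>M) \<le> 1"
    using nn_integral_image_divide_dependence_density_le[OF a dependence_densityD(1,2)[OF g]]
      nn_integral_dependence_density_eq_1[OF U Y g] by simp
  show "(\<integral>\<^sup>+\<omega>. ennreal (1 / g (U \<omega>, a (V \<omega>))) \<partial>M) \<le> 1"
    by (rule nn_integral_inverse_dependence_density_le[OF U Y g])
qed

text \<open>Gibbs' inequality is applied to the product of the two densities as competitor. The real
  witnesses \<open>i\<close> and \<open>j\<close> record that both informations are finite, so that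
  terms can later be moved across the inequality in \<open>ereal\<close>.\<close>

lemma ext_mutual_information_superadditive:
  assumes b: "1 < b" and a[measurable]: "a \<in> measurable SV SY" and c[measurable]: "c \<in> measurable SV SN"
    and int: "integrable M (\<lambda>\<omega>. log b (f (U \<omega>, V \<omega>)))"
    and indep: "distr M (SY \<Otimes>\<^sub>M SN) (\<lambda>\<omega>. (a (V \<omega>), c (V \<omega>))) =
      distr M SY (\<lambda>\<omega>. a (V \<omega>)) \<Otimes>\<^sub>M distr M SN (\<lambda>\<omega>. c (V \<omega>))"
  shows "\<exists>i j. ext_mutual_information M b SU SY U (\<lambda>\<omega>. a (V \<omega>)) = ereal i \<and>
     ext_mutual_information M b SU SN U (\<lambda>\<omega>. c (V \<omega>)) = ereal j \<and>
     i + j \<le> (\<integral>\<omega>. log b (f (U \<omega>, V \<omega>)) \<partial>M)"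
proof -
  note [measurable] = dependence_densityD(1)[OF dd]
  let ?Y = "\<lambda>\<omega>. a (V \<omega>)" and ?N = "\<lambda>\<omega>. c (V \<omega>)"
  have Y[measurable]: "?Y \<in> measurable M SY" and N[measurable]: "?N \<in> measurable M SN" by measurable
  obtain g where g: "dependence_density M SU SY U ?Y g"
    using dependence_density_image_exists[OF a] ..
  obtain h where h: "dependence_density M SU SN U ?N h"
    using dependence_density_image_exists[OF c] ..
  note [measurable] = dependence_densityD(1)[OF g] dependence_densityD(1)[OF h]
  note int_g = integrable_log_dependence_density_image[OF b a int g]
  note int_h = integrable_log_dependence_density_image[OF b c int h]
  have pos: "AE \<omega> in M. 0 < f (U \<omega>, V \<omega>)" "AE \<omega> in M. 0 < g (U \<omega>, ?Y \<omega>)" "AE \<omega> in M. 0 < h (U \<omega>, ?N \<omega>)"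
    by (rule AE_dependence_density_pos[OF U V dd] AE_dependence_density_pos[OF U Y g]
      AE_dependence_density_pos[OF U N h])+
  interpret PY: prob_space "distr M SY ?Y" by (rule prob_space_distr) (rule Y)
  interpret PN: prob_space "distr M SN ?N" by (rule prob_space_distr) (rule N)
  interpret PU: prob_space "distr M SU U" by (rule prob_space_distr) (rule U)
  interpret PYN: pair_prob_space "distr M SY ?Y" "distr M SN ?N" ..
  let ?G = "\<lambda>(u, y, n). g (u, y) * h (u, n)"
  have G[measurable]: "?G \<in> borel_measurable (SU \<Otimes>\<^sub>M (SY \<Otimes>\<^sub>M SN))" by measurable
  have G_nonneg: "0 \<le> ?G x" for x
    using dependence_densityD(2)[OF g] dependence_densityD(2)[OF h] by (auto split: prod.split)
  have "(\<integral>\<^sup>+\<omega>. ennreal (?G (U \<omega>, a (V \<omega>), c (V \<omega>)) / f (U \<omega>, V \<omega>)) \<partial>M) \<le>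
     (\<integral>\<^sup>+x. ennreal (?G x) \<partial>(distr M SU U \<Otimes>\<^sub>M distr M (SY \<Otimes>\<^sub>M SN) (\<lambda>\<omega>. (a (V \<omega>), c (V \<omega>)))))"
    using nn_integral_image_divide_dependence_density_le[OF _ G G_nonneg, of "\<lambda>v. (a v, c v)"] by simp
  \<comment> \<open>Independence enters through \<open>indep\<close>: the reference measure becomes
    a product in \<open>y\<close> and \<open>n\<close> as well, and the integral can be
    iterated.\<close>
  also have "\<dots> = (\<integral>\<^sup>+u. \<integral>\<^sup>+y. \<integral>\<^sup>+n. ennreal (g (u, y) * h (u, n)) \<partial>distr M SN ?N \<partial>distr M SY ?Y \<partial>distr M SU U)"
    unfolding indep
    by (subst PYN.nn_integral_fst[symmetric], simp, intro nn_integral_cong,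
        subst PN.nn_integral_fst[symmetric]) auto
  \<comment> \<open>For fixed \<open>u\<close> the integrand splits into a function of
    \<open>y\<close> times a function of \<open>n\<close>; for almost every \<open>u\<close> both
    slices have mass 1.\<close>
  also have "\<dots> = (\<integral>\<^sup>+u. 1 \<partial>distr M SU U)"
  proof (rule nn_integral_cong_AE)
    show "AE u in distr M SU U. (\<integral>\<^sup>+y. \<integral>\<^sup>+n. ennreal (g (u, y) * h (u, n)) \<partial>distr M SN ?N \<partial>distr M SY ?Y) = 1"
      using nn_integral_dependence_density_slice[OF U Y g] nn_integral_dependence_density_slice[OF U N h] AE_space
    proof eventually_elim
      case (elim u)
      then have [measurable]: "u \<in> space SU" by simp
      show ?case
        using elim by (simp add: ennreal_mult' dependence_densityD(2)[OF g] nn_integral_cmult)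
    qed
  qed
  also have "\<dots> = 1" using PU.emeasure_space_1 by simp
  finally have le: "(\<integral>\<^sup>+\<omega>. ennreal (g (U \<omega>, ?Y \<omega>) * h (U \<omega>, ?N \<omega>) / f (U \<omega>, V \<omega>)) \<partial>M) \<le> 1"
    by simp
  have log_eq: "AE \<omega> in M. log b (g (U \<omega>, ?Y \<omega>) * h (U \<omega>, ?N \<omega>)) =
      log b (g (U \<omega>, ?Y \<omega>)) + log b (h (U \<omega>, ?N \<omega>))"
    using pos(2,3) by eventually_elim (simp add: log_mult_pos)
  have "integrable M (\<lambda>\<omega>. log b (g (U \<omega>, ?Y \<omega>) * h (U \<omega>, ?N \<omega>)))"
    using log_eq int_g int_h by (subst integrable_cong_AE[OF _ _ log_eq]) auto
  then have "(\<integral>\<omega>. log b (g (U \<omega>, ?Y \<omega>) * h (U \<omega>, ?N \<omega>)) \<partial>M) \<le> (\<integral>\<omega>. log b (f (U \<omega>, V \<omega>)) \<partial>M)"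
    using pos int le by (intro gibbs_inequality[OF b]) auto
  also have "(\<integral>\<omega>. log b (g (U \<omega>, ?Y \<omega>) * h (U \<omega>, ?N \<omega>)) \<partial>M) =
      (\<integral>\<omega>. log b (g (U \<omega>, ?Y \<omega>)) + log b (h (U \<omega>, ?N \<omega>)) \<partial>M)"
    by (rule integral_cong_AE[OF _ _ log_eq]) auto
  also have "\<dots> = (\<integral>\<omega>. log b (g (U \<omega>, ?Y \<omega>)) \<partial>M) + (\<integral>\<omega>. log b (h (U \<omega>, ?N \<omega>)) \<partial>M)"
    using int_g int_h by simp
  finally show ?thesis
    using int_g int_h
    by (simp add: ext_mutual_information_dependence_density[OF U Y g] ext_mutual_information_dependence_density[OF U N h])
qed

end

end

section \<open>Markov chains\<close>

text \<open>Rectangles are stable under intersection and generate the product. The whole space is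
  itself a rectangle of finite measure and serves as a constant exhausting sequence.\<close>

lemma finite_measure_pair_eqI:
  assumes sets: "sets N = sets (A \<Otimes>\<^sub>M B)" "sets N' = sets (A \<Otimes>\<^sub>M B)" and "finite_measure N"
    and eq: "\<And>X Y. X \<in> sets A \<Longrightarrow> Y \<in> sets B \<Longrightarrow> emeasure N (X \<times> Y) = emeasure N' (X \<times> Y)"
  shows "N = N'"
proof (rule measure_eqI_generator_eq[OF Int_stable_pair_measure_generator[of A B] pair_measure_closed])
  interpret N: finite_measure N by fact
  show "sets N = sigma_sets (space A \<times> space B) {a \<times> b |a b. a \<in> sets A \<and> b \<in> sets B}"
    "sets N' = sigma_sets (space A \<times> space B) {a \<times> b |a b. a \<in> sets A \<and> b \<in> sets B}"
    using sets by (simp_all add: sets_pair_measure)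
  show "range (\<lambda>_::nat. space A \<times> space B) \<subseteq> {a \<times> b |a b. a \<in> sets A \<and> b \<in> sets B}"
    by auto
  show "emeasure N (space A \<times> space B) \<noteq> \<infinity>" by simp
qed (use eq in auto)

context prob_space
begin

lemma distr_pair_eq_of_indep_rv:
  assumes "indep_rv M S X T Y"
  shows "distr M (S \<Otimes>\<^sub>M T) (\<lambda>\<omega>. (X \<omega>, Y \<omega>)) = distr M S X \<Otimes>\<^sub>M distr M T Y"
proof -
  have X[measurable]: "X \<in> measurable M S" and Y[measurable]: "Y \<in> measurable M T"
    and ind: "indep_set (sets (vimage_algebra (space M) X S)) (sets (vimage_algebra (space M) Y T))"
    using assms by (auto simp: indep_rv_def)
  interpret PX: prob_space "distr M S X" by (rule prob_space_distr) (rule X)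
  interpret PY: prob_space "distr M T Y" by (rule prob_space_distr) (rule Y)
  have "distr M S X \<Otimes>\<^sub>M distr M T Y = distr M (S \<Otimes>\<^sub>M T) (\<lambda>\<omega>. (X \<omega>, Y \<omega>))"
  proof (rule pair_measure_eqI)
    fix A B assume "A \<in> sets (distr M S X)" "B \<in> sets (distr M T Y)"
    then have [measurable]: "A \<in> sets S" "B \<in> sets T" by auto
    have "prob ((X -` A \<inter> space M) \<inter> (Y -` B \<inter> space M)) =
        prob (X -` A \<inter> space M) * prob (Y -` B \<inter> space M)"
      by (rule indep_setD[OF ind]) (auto intro!: in_vimage_algebra)
    moreover have "(\<lambda>\<omega>. (X \<omega>, Y \<omega>)) -` (A \<times> B) \<inter> space M = (X -` A \<inter> space M) \<inter> (Y -` B \<inter> space M)"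
      by auto
    ultimately show "emeasure (distr M S X) A * emeasure (distr M T Y) B =
        emeasure (distr M (S \<Otimes>\<^sub>M T) (\<lambda>\<omega>. (X \<omega>, Y \<omega>))) (A \<times> B)"
      by (simp add: emeasure_distr emeasure_eq_measure ennreal_mult)
  qed (auto intro: PX.sigma_finite_measure_axioms PY.sigma_finite_measure_axioms cong: sets_pair_measure_cong)
  then show ?thesis by simp
qed

context
  fixes SU :: "'u measure" and ST :: "'t measure" and SZ :: "'z measure" and U T Z f
  assumes ci: "cond_indep_rv M SU U ST T SZ Z"
    and dd: "dependence_density M SU SZ U Z f"
begin

lemma
  shows cond_indep_U: "U \<in> measurable M SU" and cond_indep_T: "T \<in> measurable M ST"
    and cond_indep_Z: "Z \<in> measurable M SZ"
  using ci by (auto simp: cond_indep_rv_def)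

lemma subalgebra_vimage_Z: "subalgebra M (vimage_algebra (space M) Z SZ)"
  unfolding subalgebra_def using cond_indep_Z by (simp add: measurable_iff_sets)

lemma measurable_comp_vimage_Z:
  "\<phi> \<in> measurable SZ K \<Longrightarrow> (\<lambda>\<omega>. \<phi> (Z \<omega>)) \<in> measurable (vimage_algebra (space M) Z SZ) K"
  by (rule measurable_compose[OF measurable_vimage_algebra1 [OF measurable_space[OF cond_indep_Z, THEN Pi_I]]])

text \<open>The inner integral is a version of the conditional probability of
  \<open>U \<in> A\<close> given \<open>Z\<close>. By conditional independence it may stand in for
  the indicator of \<open>U \<in> A\<close> even on the event that \<open>T \<in> B\<close> and
  \<open>Z \<in> C\<close>.\<close>

lemma emeasure_markov_rectangle:
  assumes [measurable]: "A \<in> sets SU" "B \<in> sets ST" "C \<in> sets SZ"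
  shows "emeasure M {\<omega>\<in>space M. U \<omega> \<in> A \<and> T \<omega> \<in> B \<and> Z \<omega> \<in> C} =
    (\<integral>\<^sup>+\<omega>. (\<integral>\<^sup>+u. ennreal (f (u, Z \<omega>)) * indicator A u \<partial>distr M SU U) * indicator B (T \<omega>) * indicator C (Z \<omega>) \<partial>M)"
proof -
  note [measurable] = cond_indep_U cond_indep_T cond_indep_Z dependence_densityD(1)[OF dd]
  interpret PU: prob_space "distr M SU U" by (rule prob_space_distr) (rule cond_indep_U)
  interpret PZ: prob_space "distr M SZ Z" by (rule prob_space_distr) (rule cond_indep_Z)
  interpret PUZ: pair_prob_space "distr M SU U" "distr M SZ Z" ..
  let ?F = "vimage_algebra (space M) Z SZ"
  \<comment> \<open>\<open>\<Phi>\<close> is the candidate for the conditional probability. It may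
    be infinite at exceptional \<open>z\<close>, where its real version \<open>\<phi>\<close> takes
    the default value 0.\<close>
  define \<Phi> where "\<Phi> z = (\<integral>\<^sup>+u. ennreal (f (u, z)) * indicator A u \<partial>distr M SU U)" for z
  define \<phi> where "\<phi> z = enn2real (\<Phi> z)" for z
  have [measurable]: "\<Phi> \<in> borel_measurable SZ"
    unfolding \<Phi>_def by measurable
  then have [measurable]: "\<phi> \<in> borel_measurable SZ" unfolding \<phi>_def by measurable
  \<comment> \<open>The defining property of conditional probability, tested on the events
    \<open>Z \<in> D\<close>.\<close>
  have \<Phi>: "(\<integral>\<^sup>+\<omega>. \<Phi> (Z \<omega>) * indicator D (Z \<omega>) \<partial>M) = emeasure M {\<omega>\<in>space M. U \<omega> \<in> A \<and> Z \<omega> \<in> D}"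
    if [measurable]: "D \<in> sets SZ" for D
  proof -
    have "emeasure M {\<omega>\<in>space M. U \<omega> \<in> A \<and> Z \<omega> \<in> D} =
        (\<integral>\<^sup>+\<omega>. indicator {\<omega>\<in>space M. U \<omega> \<in> A \<and> Z \<omega> \<in> D} \<omega> \<partial>M)"
      by simp
    also have "\<dots> = (\<integral>\<^sup>+\<omega>. indicator A (U \<omega>) * indicator D (Z \<omega>) \<partial>M)"
      by (intro nn_integral_cong) (auto split: split_indicator)
    also have "\<dots> = (\<integral>\<^sup>+x. ennreal (f x) * (indicator A (fst x) * indicator D (snd x)) \<partial>(distr M SU U \<Otimes>\<^sub>M distr M SZ Z))"
      by (subst nn_integral_dependence_density[OF cond_indep_U cond_indep_Z dd, symmetric]) auto
    also have "\<dots> = (\<integral>\<^sup>+z. \<integral>\<^sup>+u. ennreal (f (u, z)) * (indicator A u * indicator D z) \<partial>distr M SU U \<partial>distr M SZ Z)"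
      by (subst PUZ.nn_integral_snd[symmetric]) auto
    also have "\<dots> = (\<integral>\<^sup>+z. \<Phi> z * indicator D z \<partial>distr M SZ Z)"
      unfolding \<Phi>_def
      by (intro nn_integral_cong, subst nn_integral_multc[symmetric]) (auto simp: mult.assoc)
    also have "\<dots> = (\<integral>\<^sup>+\<omega>. \<Phi> (Z \<omega>) * indicator D (Z \<omega>) \<partial>M)"
      by (subst nn_integral_distr) auto
    finally show ?thesis by simp
  qed
  have "(\<integral>\<^sup>+\<omega>. \<Phi> (Z \<omega>) \<partial>M) \<le> 1"
  proof -
    have "(\<integral>\<^sup>+\<omega>. \<Phi> (Z \<omega>) \<partial>M) = (\<integral>\<^sup>+\<omega>. \<Phi> (Z \<omega>) * indicator (space SZ) (Z \<omega>) \<partial>M)"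
      using measurable_space[OF cond_indep_Z] by (intro nn_integral_cong) auto
    then show ?thesis using \<Phi>[of "space SZ"] by (simp add: emeasure_le_1)
  qed
  then have \<Phi>_finite: "AE \<omega> in M. \<Phi> (Z \<omega>) \<noteq> \<infinity>"
    by (intro nn_integral_noteq_infinite) (auto simp: top_unique)
  then have \<phi>_eq: "AE \<omega> in M. ennreal (\<phi> (Z \<omega>)) = \<Phi> (Z \<omega>)"
    by eventually_elim (simp add: \<phi>_def less_top)
  have \<phi>_nonneg: "0 \<le> \<phi> z" for z by (simp add: \<phi>_def)
  have int_\<phi>: "integrable M (\<lambda>\<omega>. \<phi> (Z \<omega>))"
  proof (rule integrableI_nonneg)
    have "(\<integral>\<^sup>+\<omega>. ennreal (\<phi> (Z \<omega>)) \<partial>M) = (\<integral>\<^sup>+\<omega>. \<Phi> (Z \<omega>) \<partial>M)"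
      using \<phi>_eq by (rule nn_integral_cong_AE)
    then show "(\<integral>\<^sup>+\<omega>. ennreal (\<phi> (Z \<omega>)) \<partial>M) < \<infinity>"
      using \<open>_ \<le> 1\<close> by (simp add: le_less_trans)
  qed (auto simp: \<phi>_nonneg)
  interpret Z: sigma_finite_subalgebra M "vimage_algebra (space M) Z SZ"
    by (intro finite_measure_subalgebra_is_sigma_finite finite_measure_subalgebra.intro
        finite_measure_axioms finite_measure_subalgebra_axioms.intro subalgebra_vimage_Z)
  let ?UA = "U -` A \<inter> space M" and ?TB = "T -` B \<inter> space M"
  have cond_A: "AE \<omega> in M. real_cond_exp M ?F (indicator ?UA) \<omega> = \<phi> (Z \<omega>)"
  proof (rule Z.real_cond_exp_charact)
    fix D' assume "D' \<in> sets ?F"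
    then obtain D where [measurable]: "D \<in> sets SZ" and D': "D' = Z -` D \<inter> space M"
      using measurable_space[OF cond_indep_Z] by (subst (asm) sets_vimage_algebra2) auto
    have "ennreal (\<integral>\<omega>\<in>D'. indicator ?UA \<omega> \<partial>M) = emeasure M {\<omega>\<in>space M. U \<omega> \<in> A \<and> Z \<omega> \<in> D}"
    proof -
      have "(\<integral>\<omega>\<in>D'. indicator ?UA \<omega> \<partial>M :: real) = (\<integral>\<omega>. indicator {\<omega>\<in>space M. U \<omega> \<in> A \<and> Z \<omega> \<in> D} \<omega> \<partial>M)"
        unfolding D' set_lebesgue_integral_def
        by (intro Bochner_Integration.integral_cong) (auto split: split_indicator)
      then show ?thesis by (simp add: emeasure_eq_measure)
    qed
    also have "\<dots> = (\<integral>\<^sup>+\<omega>. ennreal (indicator D' \<omega> * \<phi> (Z \<omega>)) \<partial>M)"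
      unfolding \<Phi>[OF \<open>D \<in> sets SZ\<close>, symmetric] D'
      using \<phi>_eq AE_space
      by (intro nn_integral_cong_AE, eventually_elim) (auto split: split_indicator)
    also have "\<dots> = ennreal (\<integral>\<omega>\<in>D'. \<phi> (Z \<omega>) \<partial>M)"
      unfolding set_lebesgue_integral_def D' real_scaleR_def
      by (intro nn_integral_eq_integral Bochner_Integration.integrable_bound[OF int_\<phi>])
        (auto simp: \<phi>_nonneg split: split_indicator)
    finally show "(\<integral>\<omega>\<in>D'. indicator ?UA \<omega> \<partial>M) = (\<integral>\<omega>\<in>D'. \<phi> (Z \<omega>) \<partial>M)"
      by (subst (asm) ennreal_inj) (auto simp: set_lebesgue_integral_def \<phi>_nonneg intro!: Bochner_Integration.integral_nonneg)
  next
    show "integrable M (indicator ?UA :: 'a \<Rightarrow> real)"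
      by (rule integrable_const_bound[where B=1]) (auto split: split_indicator)
  qed (auto simp: int_\<phi> intro!: measurable_comp_vimage_Z)
  have ci_AB: "AE \<omega> in M. real_cond_exp M ?F (indicator (U -` A \<inter> T -` B \<inter> space M)) \<omega> =
      real_cond_exp M ?F (indicator ?UA) \<omega> * real_cond_exp M ?F (indicator ?TB) \<omega>"
    using ci assms by (auto simp: cond_indep_rv_def cond_prob_given_def)
  have C: "(\<lambda>\<omega>. indicator C (Z \<omega>) :: real) \<in> borel_measurable ?F"
    by (rule measurable_comp_vimage_Z) measurable
  have \<phi>C: "(\<lambda>\<omega>. indicator C (Z \<omega>) * \<phi> (Z \<omega>) :: real) \<in> borel_measurable ?F"
    by (rule measurable_comp_vimage_Z) measurable
  have int_C: "integrable M (\<lambda>\<omega>. indicator C (Z \<omega>) * indicator (U -` A \<inter> T -` B \<inter> space M) \<omega> :: real)"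
    by (rule integrable_const_bound[where B=1]) (auto split: split_indicator)
  have int_\<phi>C: "integrable M (\<lambda>\<omega>. (indicator C (Z \<omega>) * \<phi> (Z \<omega>)) * indicator ?TB \<omega>)"
    by (rule Bochner_Integration.integrable_bound[OF int_\<phi>]) (auto split: split_indicator simp: \<phi>_nonneg)
  have "emeasure M {\<omega>\<in>space M. U \<omega> \<in> A \<and> T \<omega> \<in> B \<and> Z \<omega> \<in> C} =
      ennreal (\<integral>\<omega>. indicator {\<omega>\<in>space M. U \<omega> \<in> A \<and> T \<omega> \<in> B \<and> Z \<omega> \<in> C} \<omega> \<partial>M)"
    by (simp add: emeasure_eq_measure)
  also have "(\<integral>\<omega>. indicator {\<omega>\<in>space M. U \<omega> \<in> A \<and> T \<omega> \<in> B \<and> Z \<omega> \<in> C} \<omega> \<partial>M :: real) =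
      (\<integral>\<omega>. indicator C (Z \<omega>) * indicator (U -` A \<inter> T -` B \<inter> space M) \<omega> \<partial>M)"
    by (intro Bochner_Integration.integral_cong) (auto split: split_indicator)
  \<comment> \<open>The factor \<open>indicator C (Z \<omega>)\<close> is known given
    \<open>Z\<close>, so a conditional expectation can be inserted under the integral. Once it is
    factorized, the one of \<open>?TB\<close> is removed in the same way, with \<open>\<phi>\<close>
    joined to the known factor.\<close>
  also have "\<dots> = (\<integral>\<omega>. indicator C (Z \<omega>) * real_cond_exp M ?F (indicator (U -` A \<inter> T -` B \<inter> space M)) \<omega> \<partial>M)"
    by (rule Z.real_cond_exp_intg(2)[OF int_C C, symmetric]) measurable
  also have "\<dots> = (\<integral>\<omega>. (indicator C (Z \<omega>) * \<phi> (Z \<omega>)) * real_cond_exp M ?F (indicator ?TB) \<omega> \<partial>M)"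
  proof (rule integral_cong_AE)
    show "AE \<omega> in M. indicator C (Z \<omega>) * real_cond_exp M ?F (indicator (U -` A \<inter> T -` B \<inter> space M)) \<omega> =
        (indicator C (Z \<omega>) * \<phi> (Z \<omega>)) * real_cond_exp M ?F (indicator ?TB) \<omega>"
      using ci_AB cond_A by eventually_elim simp
  qed measurable
  also have "\<dots> = (\<integral>\<omega>. (indicator C (Z \<omega>) * \<phi> (Z \<omega>)) * indicator ?TB \<omega> \<partial>M)"
    by (rule Z.real_cond_exp_intg(2)[OF int_\<phi>C \<phi>C]) measurable
  also have "ennreal \<dots> = (\<integral>\<^sup>+\<omega>. ennreal ((indicator C (Z \<omega>) * \<phi> (Z \<omega>)) * indicator ?TB \<omega>) \<partial>M)"
    by (rule nn_integral_eq_integral[OF int_\<phi>C, symmetric]) (auto simp: \<phi>_nonneg)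
  also have "\<dots> = (\<integral>\<^sup>+\<omega>. \<Phi> (Z \<omega>) * indicator B (T \<omega>) * indicator C (Z \<omega>) \<partial>M)"
    using \<phi>_eq AE_space
    by (intro nn_integral_cong_AE, eventually_elim) (auto split: split_indicator)
  finally show ?thesis by (simp add: \<Phi>_def)
qed

text \<open>The conditional law of \<open>U\<close> given \<open>(T, Z)\<close> depends on \<open>Z\<close> only.\<close>

lemma dependence_density_markov:
  "dependence_density M SU (ST \<Otimes>\<^sub>M SZ) U (\<lambda>\<omega>. (T \<omega>, Z \<omega>)) (\<lambda>(u, t, z). f (u, z))"
proof -
  note [measurable] = cond_indep_U cond_indep_T cond_indep_Z dependence_densityD(1)[OF dd]
  interpret PU: prob_space "distr M SU U" by (rule prob_space_distr) (rule cond_indep_U)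
  let ?V = "\<lambda>\<omega>. (T \<omega>, Z \<omega>)"
  have V[measurable]: "?V \<in> measurable M (ST \<Otimes>\<^sub>M SZ)" by measurable
  interpret PV: prob_space "distr M (ST \<Otimes>\<^sub>M SZ) ?V" by (rule prob_space_distr) (rule V)
  interpret PUV: pair_prob_space "distr M SU U" "distr M (ST \<Otimes>\<^sub>M SZ) ?V" ..
  let ?f = "\<lambda>(u, t, z). f (u, z)"
  \<comment> \<open>Uniqueness on rectangles is used twice. Here \<open>A\<close> is fixed, and
    agreement on the sets \<open>B \<times> C\<close> is extended to the law of
    \<open>(T, Z)\<close> restricted to the event \<open>U \<in> A\<close>.\<close>
  have slice: "density (distr M (ST \<Otimes>\<^sub>M SZ) (\<lambda>\<omega>. (T \<omega>, Z \<omega>)))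
        (\<lambda>v. \<integral>\<^sup>+u. ennreal (f (u, snd v)) * indicator A u \<partial>distr M SU U) =
      distr (density M (\<lambda>\<omega>. indicator A (U \<omega>))) (ST \<Otimes>\<^sub>M SZ) ?V" (is "?L = ?R")
    if [measurable]: "A \<in> sets SU" for A
  proof (rule finite_measure_pair_eqI[symmetric])
    show "finite_measure ?R"
    proof (intro finite_measure.finite_measure_distr finite_measureI)
      have "emeasure (density M (\<lambda>\<omega>. indicator A (U \<omega>))) (space M) = (\<integral>\<^sup>+\<omega>. indicator A (U \<omega>) \<partial>M)"
        by (subst emeasure_density) (auto intro!: nn_integral_cong)
      also have "\<dots> \<le> (\<integral>\<^sup>+\<omega>. 1 \<partial>M)"
        by (intro nn_integral_mono) (auto split: split_indicator)
      finally show "emeasure (density M (\<lambda>\<omega>. indicator A (U \<omega>)))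
          (space (density M (\<lambda>\<omega>. indicator A (U \<omega>)))) \<noteq> \<infinity>"
        using emeasure_space_1 by (auto simp: top_unique)
    qed measurable
    fix B C assume [measurable]: "B \<in> sets ST" "C \<in> sets SZ"
    have "emeasure ?R (B \<times> C) = (\<integral>\<^sup>+\<omega>. indicator A (U \<omega>) * indicator (?V -` (B \<times> C) \<inter> space M) \<omega> \<partial>M)"
      by (simp add: emeasure_distr emeasure_density)
    also have "\<dots> = (\<integral>\<^sup>+\<omega>. indicator {\<omega>\<in>space M. U \<omega> \<in> A \<and> T \<omega> \<in> B \<and> Z \<omega> \<in> C} \<omega> \<partial>M)"
      by (intro nn_integral_cong) (auto split: split_indicator)
    also have "\<dots> = emeasure M {\<omega>\<in>space M. U \<omega> \<in> A \<and> T \<omega> \<in> B \<and> Z \<omega> \<in> C}"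
      by simp
    also have "\<dots> = emeasure ?L (B \<times> C)"
      unfolding emeasure_markov_rectangle[OF that \<open>B \<in> _\<close> \<open>C \<in> _\<close>]
      by (subst emeasure_density, simp, simp, subst nn_integral_distr)
        (auto intro!: nn_integral_cong split: split_indicator)
    finally show "emeasure ?R (B \<times> C) = emeasure ?L (B \<times> C)" .
  qed auto
  \<comment> \<open>The second extension: from sets \<open>A \<times> D\<close>, with
    \<open>D\<close> now an arbitrary measurable set of pairs, to the space of triples.\<close>
  have "distr M (SU \<Otimes>\<^sub>M (ST \<Otimes>\<^sub>M SZ)) (\<lambda>\<omega>. (U \<omega>, ?V \<omega>)) =
       density (distr M SU U \<Otimes>\<^sub>M distr M (ST \<Otimes>\<^sub>M SZ) ?V) (\<lambda>x. ennreal (?f x))" (is "?L = ?R")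
  proof (rule finite_measure_pair_eqI)
    show "finite_measure ?L" by (intro finite_measure_distr) measurable
    fix A D assume [measurable]: "A \<in> sets SU" "D \<in> sets (ST \<Otimes>\<^sub>M SZ)"
    have "emeasure ?R (A \<times> D) = (\<integral>\<^sup>+v. (\<integral>\<^sup>+u. ennreal (?f (u, v)) * indicator (A \<times> D) (u, v) \<partial>distr M SU U) \<partial>distr M (ST \<Otimes>\<^sub>M SZ) ?V)"
      by (subst emeasure_density, simp, simp, subst PUV.nn_integral_snd[symmetric]) auto
    also have "\<dots> = (\<integral>\<^sup>+v. (\<integral>\<^sup>+u. ennreal (f (u, snd v)) * indicator A u \<partial>distr M SU U) * indicator D v \<partial>distr M (ST \<Otimes>\<^sub>M SZ) ?V)"
      by (intro nn_integral_cong, subst nn_integral_multc[symmetric])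
        (auto intro!: nn_integral_cong split: split_indicator prod.split)
    also have "\<dots> = emeasure (density (distr M (ST \<Otimes>\<^sub>M SZ) ?V)
        (\<lambda>v. \<integral>\<^sup>+u. ennreal (f (u, snd v)) * indicator A u \<partial>distr M SU U)) D"
      by (subst emeasure_density) auto
    also have "\<dots> = (\<integral>\<^sup>+\<omega>. indicator A (U \<omega>) * indicator (?V -` D \<inter> space M) \<omega> \<partial>M)"
      unfolding slice[OF \<open>A \<in> _\<close>] by (simp add: emeasure_distr emeasure_density)
    also have "\<dots> = (\<integral>\<^sup>+\<omega>. indicator ((\<lambda>\<omega>. (U \<omega>, ?V \<omega>)) -` (A \<times> D) \<inter> space M) \<omega> \<partial>M)"
      by (intro nn_integral_cong) (auto split: split_indicator)
    also have "\<dots> = emeasure ?L (A \<times> D)"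
      by (subst nn_integral_indicator) (auto simp: emeasure_distr)
    finally show "emeasure ?L (A \<times> D) = emeasure ?R (A \<times> D)" ..
  qed (auto cong: sets_pair_measure_cong)
  then show ?thesis
    using dependence_densityD(2)[OF dd] by (auto simp: dependence_density_def)
qed

end

end

section \<open>Discrete random variables and sparse masks\<close>

text \<open>A mask vanishes off \<open>K\<close>, so restricting it to \<open>K\<close> loses
  nothing and embeds these masks into the functions from \<open>K\<close> to
  \<open>{..<n}\<close>.\<close>

lemma
  fixes K :: "('h::finite \<times> 'w::finite) set" and n :: nat
  shows finite_supported_masks: "finite {m :: nat ^ 'w ^ 'h. {(i, j). m $ i $ j \<noteq> 0} \<subseteq> K \<and> (\<forall>i j. m $ i $ j < n)}" (is "finite ?A")
    and card_supported_masks_le: "card {m :: nat ^ 'w ^ 'h. {(i, j). m $ i $ j \<noteq> 0} \<subseteq> K \<and> (\<forall>i j. m $ i $ j < n)} \<le> n ^ card K"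
proof -
  let ?F = "\<lambda>m :: nat ^ 'w ^ 'h. restrict (\<lambda>(i, j). m $ i $ j) K"
  have inj: "inj_on ?F ?A"
  proof (rule inj_onI)
    fix m m' assume m: "m \<in> ?A" and m': "m' \<in> ?A" and eq: "?F m = ?F m'"
    have "m $ i $ j = m' $ i $ j" for i j
    proof (cases "(i, j) \<in> K")
      case True
      then show ?thesis using fun_cong[OF eq, of "(i, j)"] by simp
    next
      case False
      then have "m $ i $ j = 0" "m' $ i $ j = 0" using m m' by blast+
      then show ?thesis by simp
    qed
    then show "m = m'" by (simp add: vec_eq_iff)
  qed
  have sub: "?F ` ?A \<subseteq> K \<rightarrow>\<^sub>E {..<n}" by auto
  have fin: "finite (K \<rightarrow>\<^sub>E {..<n})" by (intro finite_PiE) auto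
  show "finite ?A" using finite_imageD[OF finite_subset[OF sub fin] inj] .
  have "card ?A \<le> card (K \<rightarrow>\<^sub>E {..<n})"
    using card_inj_on_le[OF inj sub fin] .
  then show "card ?A \<le> n ^ card K" by (simp add: card_PiE)
qed

text \<open>A support of at most \<open>k\<close> positions extends to a set \<open>K\<close> of
  exactly \<open>k\<close>, by the bound on \<open>k\<close>. Masks with smaller support may be
  counted for several \<open>K\<close>, so this is only an upper bound.\<close>

lemma
  fixes k n :: nat
  assumes k: "k \<le> CARD('h::finite) * CARD('w::finite)"
  shows finite_sparse_masks: "finite {m :: nat ^ 'w ^ 'h. card {(i, j). m $ i $ j \<noteq> 0} \<le> k \<and> (\<forall>i j. m $ i $ j < n)}" (is "finite ?S")
    and card_sparse_masks_le: "card {m :: nat ^ 'w ^ 'h. card {(i, j). m $ i $ j \<noteq> 0} \<le> k \<and> (\<forall>i j. m $ i $ j < n)}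
      \<le> (CARD('h) * CARD('w) choose k) * n ^ k"
proof -
  let ?\<K> = "{K :: ('h \<times> 'w) set. card K = k}"
  let ?A = "\<lambda>K. {m :: nat ^ 'w ^ 'h. {(i, j). m $ i $ j \<noteq> 0} \<subseteq> K \<and> (\<forall>i j. m $ i $ j < n)}"
  have sub: "?S \<subseteq> (\<Union>K\<in>?\<K>. ?A K)"
  proof
    fix m assume m: "m \<in> ?S"
    have "k \<le> card (UNIV :: ('h \<times> 'w) set)" using k by (simp add: card_prod)
    then obtain K where "{(i, j). m $ i $ j \<noteq> 0} \<subseteq> K" "card K = k"
      using exists_subset_between[of "{(i, j). m $ i $ j \<noteq> 0}" k UNIV] m by auto
    with m show "m \<in> (\<Union>K\<in>?\<K>. ?A K)" by auto
  qed
  have fin: "finite (\<Union>K\<in>?\<K>. ?A K)" by (intro finite_UN_I finite_supported_masks) auto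
  with sub show "finite ?S" by (rule finite_subset)
  have "card ?S \<le> card (\<Union>K\<in>?\<K>. ?A K)" using fin sub by (rule card_mono)
  also have "\<dots> \<le> (\<Sum>K\<in>?\<K>. card (?A K))" by (rule card_UN_le) auto
  also have "\<dots> \<le> (\<Sum>K\<in>?\<K>. n ^ k)" by (intro sum_mono order_trans[OF card_supported_masks_le]) auto
  also have "\<dots> = (CARD('h) * CARD('w) choose k) * n ^ k"
    using n_subsets[of "UNIV :: ('h \<times> 'w) set" k] by (simp add: card_prod)
  finally show "card ?S \<le> (CARD('h) * CARD('w) choose k) * n ^ k" .
qed

section \<open>Laws, log-probabilities and entropy of variables with finitely many values\<close>

lemma (in prob_space) prob_vimage_singleton_eq_0:
  assumes X: "X \<in> measurable M (count_space UNIV)" and S: "AE \<omega> in M. X \<omega> \<in> S" and x: "x \<notin> S"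
  shows "prob (X -` {x} \<inter> space M) = 0"
proof -
  have "AE \<omega> in M. \<omega> \<notin> X -` {x} \<inter> space M" using S by eventually_elim (use x in auto)
  then have "X -` {x} \<inter> space M \<in> null_sets M"
    using X by (subst AE_iff_null_sets) auto
  then show ?thesis by (auto simp: null_sets_def measure_def)
qed

text \<open>Up to a null event, \<open>X \<in> A\<close> is a finite union of events
  \<open>X = x\<close> with \<open>x \<in> A \<inter> S\<close>. Points outside \<open>S\<close>
  have probability 0, so the reference measure can be counting measure on the whole type.\<close>

lemma (in prob_space) distributed_discrete:
  assumes M: "X \<in> measurable M (count_space UNIV)" and S: "AE \<omega> in M. X \<omega> \<in> S" "finite S"
  shows "distributed M (count_space UNIV) X (\<lambda>x. ennreal (prob (X -` {x} \<inter> space M)))"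
  unfolding distributed_def
proof (intro conjI)
  note [measurable] = M
  let ?p = "\<lambda>x. ennreal (prob (X -` {x} \<inter> space M))"
  have p0: "?p x = 0" if "x \<notin> S" for x
    using prob_vimage_singleton_eq_0[OF M S(1) that] by simp
  show "distr M (count_space UNIV) X = density (count_space UNIV) ?p"
  proof (rule measure_eqI)
    fix A :: "'b set"
    have "emeasure (distr M (count_space UNIV) X) A = emeasure M (X -` A \<inter> space M)"
      by (simp add: emeasure_distr)
    also have "\<dots> = emeasure M (\<Union>x\<in>A \<inter> S. X -` {x} \<inter> space M)"
    proof (rule emeasure_eq_AE)
      show "AE \<omega> in M. \<omega> \<in> X -` A \<inter> space M \<longleftrightarrow> \<omega> \<in> (\<Union>x\<in>A \<inter> S. X -` {x} \<inter> space M)"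
        using S(1) by eventually_elim auto
      show "(\<Union>x\<in>A \<inter> S. X -` {x} \<inter> space M) \<in> events"
        using S(2) by (intro sets.finite_UN) auto
    qed auto
    also have "\<dots> = (\<Sum>x\<in>A \<inter> S. emeasure M (X -` {x} \<inter> space M))"
      using S(2) by (intro sum_emeasure[symmetric]) (auto simp: disjoint_family_on_def)
    also have "\<dots> = (\<Sum>x\<in>S. ?p x * indicator A x)"
      using S(2) by (intro sum.mono_neutral_cong_left) (auto simp: emeasure_eq_measure indicator_def split: if_splits)
    also have "\<dots> = (\<integral>\<^sup>+x. ?p x * indicator A x \<partial>count_space UNIV)"
      using p0 S(2) by (subst nn_integral_count_space'[of S]) auto
    also have "\<dots> = emeasure (density (count_space UNIV) ?p) A"
      by (simp add: emeasure_density)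
    finally show "emeasure (distr M (count_space UNIV) X) A = emeasure (density (count_space UNIV) ?p) A" .
  qed simp
qed (use M in auto)

text \<open>Almost surely only the finitely many values of the logarithm on \<open>S\<close> occur,
  so it is bounded by the sum of their absolute values.\<close>

lemma (in prob_space) integrable_log_prob_discrete:
  fixes b :: real
  assumes M: "X \<in> measurable M (count_space UNIV)" and S: "AE \<omega> in M. X \<omega> \<in> S" "finite S"
  shows "integrable M (\<lambda>\<omega>. log b (prob (X -` {X \<omega>} \<inter> space M)))"
proof (rule integrable_const_bound)
  let ?l = "\<lambda>x. log b (prob (X -` {x} \<inter> space M))"
  show "AE \<omega> in M. norm (?l (X \<omega>)) \<le> (\<Sum>x\<in>S. \<bar>?l x\<bar>)"
    using S(1)
  proof eventually_elim
    case (elim \<omega>)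
    then show ?case using S(2) member_le_sum[of "X \<omega>" S "\<lambda>x. \<bar>?l x\<bar>"] by auto
  qed
  show "(\<lambda>\<omega>. ?l (X \<omega>)) \<in> borel_measurable M"
    by (rule measurable_compose[OF M]) simp
qed

text \<open>Only finitely many points of \<open>S\<close> can have probability 0, so avoiding all of
  them is still almost sure.\<close>

lemma (in prob_space) AE_prob_vimage_singleton_pos:
  assumes X[measurable]: "X \<in> measurable M (count_space UNIV)" and S: "AE \<omega> in M. X \<omega> \<in> S" "finite S"
  shows "AE \<omega> in M. 0 < prob (X -` {X \<omega>} \<inter> space M)"
proof -
  have "AE \<omega> in M. \<forall>x\<in>S. prob (X -` {x} \<inter> space M) = 0 \<longrightarrow> X \<omega> \<noteq> x"
  proof (rule eventually_ball_finite[OF S(2)], intro ballI)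
    fix x
    show "AE \<omega> in M. prob (X -` {x} \<inter> space M) = 0 \<longrightarrow> X \<omega> \<noteq> x"
    proof (cases "prob (X -` {x} \<inter> space M) = 0")
      case True
      then have "X -` {x} \<inter> space M \<in> null_sets M" by (simp add: null_sets_def emeasure_eq_measure)
      then have "AE \<omega> in M. \<omega> \<notin> X -` {x} \<inter> space M" by (rule AE_not_in)
      with AE_space show ?thesis by eventually_elim auto
    qed simp
  qed
  with S(1) show ?thesis by eventually_elim (auto simp: zero_less_measure_iff)
qed

lemma (in prob_space) sum_prob_vimage_singleton_le_1:
  assumes X[measurable]: "X \<in> measurable M (count_space UNIV)" and "finite S"
  shows "(\<Sum>x\<in>S. prob (X -` {x} \<inter> space M)) \<le> 1"
proof -
  have "(\<Sum>x\<in>S. prob (X -` {x} \<inter> space M)) = prob (\<Union>x\<in>S. X -` {x} \<inter> space M)"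
    using assms(2) by (intro finite_measure_finite_Union[symmetric]) (auto simp: disjoint_family_on_def)
  then show ?thesis by simp
qed

context information_space
begin

context
  fixes X :: "'a \<Rightarrow> 'x" and S
  assumes X: "X \<in> measurable M (count_space UNIV)" and S: "AE \<omega> in M. X \<omega> \<in> S" "finite S"
begin

text \<open>As an expectation over \<open>M\<close>, entropy can be merged with an information under
  one integral.\<close>

lemma entropy_discrete:
  "entropy b (count_space UNIV) X = - (\<integral>\<omega>. log b (prob (X -` {X \<omega>} \<inter> space M)) \<partial>M)"
proof -
  note D = distributed_discrete[OF X S]
  show ?thesis
    using distributed_integral[OF D, of "\<lambda>x. log b (prob (X -` {x} \<inter> space M))"]
    by (subst entropy_distr[OF D]) simp_all
qed

lemma entropy_discrete_le_log_card:
  "entropy b (count_space UNIV) X \<le> log b (card S)"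
proof -
  note D = distributed_discrete[OF X S]
  let ?p = "\<lambda>x. prob (X -` {x} \<inter> space M)" and ?N = "{x. prob (X -` {x} \<inter> space M) \<noteq> 0}"
  have N: "?N \<subseteq> S"
    using prob_vimage_singleton_eq_0[OF X S(1)] by auto
  then have fin: "finite ?N" using S(2) by (rule finite_subset)
  have "integrable (count_space UNIV) (\<lambda>x. ?p x * log b (?p x))"
    using integrable_log_prob_discrete[OF X S]
    by (subst distributed_integrable[OF D]) auto
  then have "entropy b (count_space UNIV) X \<le> log b (measure (count_space UNIV) {x \<in> space (count_space UNIV). ?p x \<noteq> 0})"
    using fin by (intro entropy_le[OF D]) auto
  also have "measure (count_space UNIV) {x \<in> space (count_space UNIV). ?p x \<noteq> 0} = card ?N"
    using fin by (simp add: measure_def)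
  \<comment> \<open>Monotonicity of \<open>log\<close> needs a positive argument, so
    \<open>?N\<close> must be nonempty: a probability cannot live on the empty set.\<close>
  also have "log b (card ?N) \<le> log b (card S)"
  proof (rule Transcendental.log_mono[OF b_gt_1])
    have "emeasure (count_space UNIV) ?N \<noteq> 0"
      using distributed_imp_emeasure_nonzero[OF D] by simp
    then have "?N \<noteq> {}" by (metis emeasure_empty)
    then show "0 < real (card ?N)" using fin by (simp add: card_gt_0_iff)
    show "real (card ?N) \<le> real (card S)" using card_mono[OF S(2) N] by simp
  qed
  finally show ?thesis .
qed

end
end

section \<open>Adjoining a discrete variable\<close>

context prob_space
begin

context
  fixes SE :: "'e measure" and SZ :: "'z measure" and E Z and X :: "'a \<Rightarrow> 'x" and S f
  assumes E: "E \<in> measurable M SE" and Z: "Z \<in> measurable M SZ"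
    and X: "X \<in> measurable M (count_space UNIV)" and S: "AE \<omega> in M. X \<omega> \<in> S" "finite S"
    and dd: "dependence_density M SE SZ E Z f"
begin

text \<open>For each fixed value \<open>m\<close> of \<open>X\<close>, absolute continuity of the
  law of \<open>(E, Z)\<close> shows that a bad slice is almost surely avoided; the finitely many
  \<open>m \<in> S\<close> are then combined.\<close>

lemma dependence_density_pair_discrete_exists:
  "\<exists>h. dependence_density M (SE \<Otimes>\<^sub>M count_space UNIV) SZ (\<lambda>\<omega>. (E \<omega>, X \<omega>)) Z h"
proof (rule dependence_density_exists)
  note [measurable] = E Z X dependence_densityD(1)[OF dd]
  let ?SU = "SE \<Otimes>\<^sub>M count_space UNIV" and ?U = "\<lambda>\<omega>. (E \<omega>, X \<omega>)"
  have U[measurable]: "?U \<in> measurable M ?SU" by measurable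
  interpret PE: prob_space "distr M SE E" by (rule prob_space_distr) (rule E)
  interpret PU: prob_space "distr M ?SU ?U" by (rule prob_space_distr) (rule U)
  interpret PZ: prob_space "distr M SZ Z" by (rule prob_space_distr) (rule Z)
  interpret PEZ: pair_prob_space "distr M SE E" "distr M SZ Z" ..
  interpret PUZ: pair_prob_space "distr M ?SU ?U" "distr M SZ Z" ..
  show "absolutely_continuous (distr M ?SU ?U \<Otimes>\<^sub>M distr M SZ Z) (distr M (?SU \<Otimes>\<^sub>M SZ) (\<lambda>\<omega>. (?U \<omega>, Z \<omega>)))"
    unfolding absolutely_continuous_def
  proof
    fix A assume A: "A \<in> null_sets (distr M ?SU ?U \<Otimes>\<^sub>M distr M SZ Z)"
    then have A_sets: "A \<in> sets (distr M ?SU ?U \<Otimes>\<^sub>M distr M SZ Z)" by auto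
    then have [measurable]: "A \<in> sets (?SU \<Otimes>\<^sub>M SZ)" by (simp cong: sets_pair_measure_cong)
    \<comment> \<open>\<open>?G\<close> marks the points \<open>u = (e, m)\<close> over which the
      slice of \<open>A\<close> is null. With \<open>m\<close> frozen, \<open>e\<close> follows the
      whole law of \<open>E\<close>, and \<open>?G\<close> may fail; it is carried as a premise
      until \<open>m\<close> becomes the actual value of \<open>X\<close>.\<close>
    let ?G = "\<lambda>u. emeasure (distr M SZ Z) (Pair u -` A) = 0"
    have G[measurable]: "Measurable.pred ?SU ?G"
      using PZ.measurable_emeasure_Pair[OF A_sets] by measurable
    have "AE u in distr M ?SU ?U. ?G u"
      using A PZ.measurable_emeasure_Pair[OF A_sets]
      by (simp add: null_sets_def PZ.emeasure_pair_measure_alt nn_integral_0_iff_AE)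
    then have good: "AE \<omega> in M. ?G (?U \<omega>)"
      by (subst (asm) AE_distr_iff) auto
    have "AE \<omega> in M. ?G (E \<omega>, m) \<longrightarrow> ((E \<omega>, m), Z \<omega>) \<notin> A" for m
    proof -
      have "AE x in distr M SE E \<Otimes>\<^sub>M distr M SZ Z. ?G (fst x, m) \<longrightarrow> ((fst x, m), snd x) \<notin> A"
      proof (rule PEZ.AE_pair_measure)
        show "AE e in distr M SE E. AE z in distr M SZ Z. ?G (fst (e, z), m) \<longrightarrow> ((fst (e, z), m), snd (e, z)) \<notin> A"
        proof (rule AE_I2)
          fix e assume "e \<in> space (distr M SE E)"
          have "Pair (e, m) -` A \<in> sets (distr M SZ Z)" using A_sets by (rule sets_Pair1)
          then show "AE z in distr M SZ Z. ?G (fst (e, z), m) \<longrightarrow> ((fst (e, z), m), snd (e, z)) \<notin> A"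
            using AE_not_in[of "Pair (e, m) -` A" "distr M SZ Z"] by (auto simp: null_sets_def)
        qed
      qed measurable
      then have "AE x in density (distr M SE E \<Otimes>\<^sub>M distr M SZ Z) (\<lambda>x. ennreal (f x)). ?G (fst x, m) \<longrightarrow> ((fst x, m), snd x) \<notin> A"
        by (subst AE_density) auto
      then show ?thesis
        unfolding dependence_densityD(3)[OF dd, symmetric] by (subst (asm) AE_distr_iff) auto
    qed
    then have "AE \<omega> in M. \<forall>m\<in>S. ?G (E \<omega>, m) \<longrightarrow> ((E \<omega>, m), Z \<omega>) \<notin> A"
      by (intro eventually_ball_finite[OF S(2)]) auto
    with S(1) good have "AE \<omega> in M. (?U \<omega>, Z \<omega>) \<notin> A" by eventually_elim auto
    then show "A \<in> null_sets (distr M (?SU \<Otimes>\<^sub>M SZ) (\<lambda>\<omega>. (?U \<omega>, Z \<omega>)))"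
      by (subst null_sets_distr_iff) (auto simp: AE_iff_null_sets vimage_def Int_def conj_commute)
  qed
qed (use E X Z in measurable)

text \<open>No conditional entropy is needed: the density \<open>h\<close> of the dependence between \<open>(E, X)\<close> and \<open>Z\<close>
  exceeds \<open>f / p\<close>, with \<open>p\<close> the probability of the value of \<open>X\<close>, by a factor of expectation at most 1,
  since \<open>z \<mapsto> h((e, m), z)\<close> is a probability density for almost all \<open>(e, m)\<close>.\<close>

lemma nn_integral_pair_discrete_density_ratio_le:
  assumes h: "dependence_density M (SE \<Otimes>\<^sub>M count_space UNIV) SZ (\<lambda>\<omega>. (E \<omega>, X \<omega>)) Z h"
  shows "(\<integral>\<^sup>+\<omega>. ennreal (h ((E \<omega>, X \<omega>), Z \<omega>) / (f (E \<omega>, Z \<omega>) / prob (X -` {X \<omega>} \<inter> space M))) \<partial>M) \<le> 1"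
proof -
  note [measurable] = E Z X dependence_densityD(1)[OF dd] dependence_densityD(1)[OF h]
  let ?SU = "SE \<Otimes>\<^sub>M count_space UNIV" and ?U = "\<lambda>\<omega>. (E \<omega>, X \<omega>)"
  let ?p = "\<lambda>m. prob (X -` {m} \<inter> space M)"
  have U[measurable]: "?U \<in> measurable M ?SU" by measurable
  interpret PE: prob_space "distr M SE E" by (rule prob_space_distr) (rule E)
  interpret PZ: prob_space "distr M SZ Z" by (rule prob_space_distr) (rule Z)
  interpret PEZ: pair_prob_space "distr M SE E" "distr M SZ Z" ..
  let ?G = "\<lambda>u. (\<integral>\<^sup>+z. ennreal (h (u, z)) \<partial>distr M SZ Z) \<le> 1"
  have [measurable]: "Measurable.pred ?SU ?G" by measurable
  have "AE u in distr M ?SU ?U. ?G u"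
    using nn_integral_dependence_density_slice[OF U Z h] by eventually_elim simp
  then have good: "AE \<omega> in M. ?G (?U \<omega>)"
    by (subst (asm) AE_distr_iff) auto
  \<comment> \<open>Cutting \<open>h\<close> to 0 where its slice has mass above 1 makes the bound
    valid for every \<open>e\<close> and \<open>m\<close>. The slice property of \<open>h\<close> is
    known only almost everywhere for the law of \<open>(E, X)\<close>, which does not cover a frozen
    \<open>m\<close> under the law of \<open>E\<close> alone.\<close>
  define g where "g m x = (if ?G (fst x, m) then h ((fst x, m), snd x) else 0)" for m x
  have g_nonneg: "0 \<le> g m x" for m x by (simp add: g_def dependence_densityD(2)[OF h])
  have g[measurable]: "g m \<in> borel_measurable (SE \<Otimes>\<^sub>M SZ)" for m
    unfolding g_def by measurable
  have g_le: "(\<integral>\<^sup>+x. ennreal (g m x) \<partial>(distr M SE E \<Otimes>\<^sub>M distr M SZ Z)) \<le> 1" for m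
  proof -
    have "(\<integral>\<^sup>+x. ennreal (g m x) \<partial>(distr M SE E \<Otimes>\<^sub>M distr M SZ Z)) =
        (\<integral>\<^sup>+e. \<integral>\<^sup>+z. ennreal (g m (e, z)) \<partial>distr M SZ Z \<partial>distr M SE E)"
      by (subst PZ.nn_integral_fst[symmetric]) auto
    also have "\<dots> \<le> (\<integral>\<^sup>+e. 1 \<partial>distr M SE E)"
    proof (rule nn_integral_mono)
      fix e
      show "(\<integral>\<^sup>+z. ennreal (g m (e, z)) \<partial>distr M SZ Z) \<le> 1"
        by (cases "?G (e, m)") (simp_all add: g_def)
    qed
    finally show ?thesis using PE.emeasure_space_1 by simp
  qed
  have "(\<integral>\<^sup>+\<omega>. ennreal (h (?U \<omega>, Z \<omega>) / (f (E \<omega>, Z \<omega>) / ?p (X \<omega>))) \<partial>M) \<le>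
      (\<integral>\<^sup>+\<omega>. (\<Sum>m\<in>S. ennreal (?p m) * ennreal (g m (E \<omega>, Z \<omega>) / f (E \<omega>, Z \<omega>))) \<partial>M)"
  proof (rule nn_integral_mono_AE)
    show "AE \<omega> in M. ennreal (h (?U \<omega>, Z \<omega>) / (f (E \<omega>, Z \<omega>) / ?p (X \<omega>))) \<le>
        (\<Sum>m\<in>S. ennreal (?p m) * ennreal (g m (E \<omega>, Z \<omega>) / f (E \<omega>, Z \<omega>)))"
      using S(1) good
    proof eventually_elim
      case (elim \<omega>)
      have "ennreal (h (?U \<omega>, Z \<omega>) / (f (E \<omega>, Z \<omega>) / ?p (X \<omega>))) =
          ennreal (?p (X \<omega>)) * ennreal (g (X \<omega>) (E \<omega>, Z \<omega>) / f (E \<omega>, Z \<omega>))"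
        using elim by (simp add: g_def ennreal_mult'[symmetric] mult.commute)
      \<comment> \<open>The term for \<open>m = X \<omega>\<close> is one of the nonnegative
        summands. Passing to the full sum turns \<open>m\<close> into a constant before
        integrating.\<close>
      also have "\<dots> \<le> (\<Sum>m\<in>S. ennreal (?p m) * ennreal (g m (E \<omega>, Z \<omega>) / f (E \<omega>, Z \<omega>)))"
        using elim S(2) by (intro member_le_sum) auto
      finally show ?case .
    qed
  qed
  also have "\<dots> = (\<Sum>m\<in>S. ennreal (?p m) * (\<integral>\<^sup>+\<omega>. ennreal (g m (E \<omega>, Z \<omega>) / f (E \<omega>, Z \<omega>)) \<partial>M))"
    by (subst nn_integral_sum) (auto simp: nn_integral_cmult)
  also have "\<dots> \<le> (\<Sum>m\<in>S. ennreal (?p m) * 1)"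
    using order_trans[OF nn_integral_divide_dependence_density_le[OF E Z dd g g_nonneg] g_le]
    by (intro sum_mono mult_left_mono) auto
  also have "\<dots> = ennreal (\<Sum>m\<in>S. ?p m)" by simp
  also have "\<dots> \<le> 1"
    using sum_prob_vimage_singleton_le_1[OF X S(2)] by (simp add: ennreal_le_1)
  finally show ?thesis .
qed

end

text \<open>The mean of the logarithm of \<open>f / p\<close>, with \<open>p\<close> the probability
  of the value of \<open>X\<close>, is the right-hand side. In Gibbs' inequality the true density
  \<open>h\<close> takes the place of the competitor and \<open>f / p\<close> that of the given
  density, as only the mean ratio counts. If the information of \<open>E\<close> is infinite, so is
  the right-hand side.\<close>

lemma ext_mutual_information_pair_discrete_le:
  fixes X :: "'a \<Rightarrow> 'x"
  assumes b: "1 < b" and E: "E \<in> measurable M SE" and Z: "Z \<in> measurable M SZ"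
    and X: "X \<in> measurable M (count_space UNIV)" and S: "AE \<omega> in M. X \<omega> \<in> S" "finite S"
  shows "ext_mutual_information M b (SE \<Otimes>\<^sub>M count_space UNIV) SZ (\<lambda>\<omega>. (E \<omega>, X \<omega>)) Z \<le>
    ext_mutual_information M b SE SZ E Z + ereal (entropy b (count_space UNIV) X)"
proof (cases "ext_mutual_information M b SE SZ E Z = \<infinity>")
  case False
  then obtain f where dd: "dependence_density M SE SZ E Z f"
    using dependence_density_exists_of_finite_ext_mutual_information[OF E Z] by blast
  let ?SU = "SE \<Otimes>\<^sub>M count_space UNIV" and ?U = "\<lambda>\<omega>. (E \<omega>, X \<omega>)"
  let ?p = "\<lambda>m. prob (X -` {m} \<inter> space M)"
  interpret information_space M b by standard (rule b)
  have U: "?U \<in> measurable M ?SU" using E X by measurable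
  obtain h where h: "dependence_density M ?SU SZ ?U Z h"
    using dependence_density_pair_discrete_exists[OF E Z X S dd] by blast
  note [measurable] = E Z X dependence_densityD(1)[OF dd] dependence_densityD(1)[OF h]
  have [measurable]: "(\<lambda>\<omega>. ?p (X \<omega>)) \<in> borel_measurable M"
    by (rule measurable_compose[OF X]) simp
  have int_f: "integrable M (\<lambda>\<omega>. log b (f (E \<omega>, Z \<omega>)))"
    using False by (simp add: ext_mutual_information_dependence_density[OF E Z dd] split: if_splits)
  note int_p = integrable_log_prob_discrete[OF X S, of b]
  note pos = AE_dependence_density_pos[OF E Z dd] AE_dependence_density_pos[OF U Z h]
    AE_prob_vimage_singleton_pos[OF X S]
  let ?F = "\<lambda>\<omega>. f (E \<omega>, Z \<omega>) / ?p (X \<omega>)"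
  have F_pos: "AE \<omega> in M. 0 < ?F \<omega>" using pos(1,3) by eventually_elim simp
  have log_eq: "AE \<omega> in M. log b (?F \<omega>) = log b (f (E \<omega>, Z \<omega>)) - log b (?p (X \<omega>))"
    using pos(1,3) by eventually_elim (simp add: log_divide_pos)
  have int_F: "integrable M (\<lambda>\<omega>. log b (?F \<omega>))"
    using int_f int_p by (subst integrable_cong_AE[OF _ _ log_eq]) auto
  note ratio = nn_integral_pair_discrete_density_ratio_le[OF E Z X S dd h]
  \<comment> \<open>The ratio bound also makes this logarithm integrable, so the information of the
    pair is finite.\<close>
  have int_h: "integrable M (\<lambda>\<omega>. log b (h (?U \<omega>, Z \<omega>)))"
    using nn_integral_inverse_dependence_density_le[OF U Z h] ratio
    by (intro integrable_log_of_le[OF b _ _ pos(2) F_pos int_F]) auto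
  have "(\<integral>\<omega>. log b (h (?U \<omega>, Z \<omega>)) \<partial>M) \<le> (\<integral>\<omega>. log b (?F \<omega>) \<partial>M)"
    using ratio by (intro gibbs_inequality[OF b _ _ pos(2) F_pos int_F int_h]) auto
  also have "\<dots> = (\<integral>\<omega>. log b (f (E \<omega>, Z \<omega>)) - log b (?p (X \<omega>)) \<partial>M)"
    by (rule integral_cong_AE[OF _ _ log_eq]) auto
  also have "\<dots> = (\<integral>\<omega>. log b (f (E \<omega>, Z \<omega>)) \<partial>M) + entropy b (count_space UNIV) X"
    using int_f int_p by (simp add: entropy_discrete[OF X S])
  finally show ?thesis
    using int_f int_h
    by (simp add: ext_mutual_information_dependence_density[OF E Z dd] ext_mutual_information_dependence_density[OF U Z h])
qed simp

end

section \<open>Noise and rate bounds for the message unit \<open>(E, M)\<close>\<close>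

theorem lemma1:
  fixes P :: "'a measure"
    and SY :: "'y measure" and SN :: "'n measure" and SX :: "'x measure"
    and Y :: "'a \<Rightarrow> 'y" and Y\<^sub>N :: "'a \<Rightarrow> 'n" and X :: "'a \<Rightarrow> 'x"
    and Z :: "'a \<Rightarrow> real ^ 'w ^ 'h ^ 'c"
    and E :: "'a \<Rightarrow> real ^ 'd"
    and M :: "'a \<Rightarrow> nat ^ 'w ^ 'h"
    and b k :: nat and \<alpha> :: real
  assumes "prob_space P"
    and "b > 0" and "0 < \<alpha>" and "\<alpha> \<le> 1"
    and "k = nat \<lfloor>\<alpha> * real (CARD('h) * CARD('w))\<rfloor>"
    and "Y \<in> measurable P SY" and "Y\<^sub>N \<in> measurable P SN" and "X \<in> measurable P SX"
    and "Z \<in> measurable P borel" and "E \<in> measurable P borel"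
    and "M \<in> measurable P (count_space UNIV)"
    and "AE \<omega> in P. card {(i, j). M \<omega> $ i $ j \<noteq> 0} \<le> k"
    and "AE \<omega> in P. \<forall>i j. M \<omega> $ i $ j \<in> {0..2 ^ b - 1}"
    and "indep_rv P SY Y SN Y\<^sub>N"
    and "markov_chain4 P (SY \<Otimes>\<^sub>M SN) (\<lambda>\<omega>. (Y \<omega>, Y\<^sub>N \<omega>)) SX X borel Z
           (borel \<Otimes>\<^sub>M count_space UNIV) (\<lambda>\<omega>. (E \<omega>, M \<omega>))"
  shows "(\<not> (ext_mutual_information P 2 (borel \<Otimes>\<^sub>M count_space UNIV) borel (\<lambda>\<omega>. (E \<omega>, M \<omega>)) Z = \<infinity> \<and>
             ext_mutual_information P 2 (borel \<Otimes>\<^sub>M count_space UNIV) SY (\<lambda>\<omega>. (E \<omega>, M \<omega>)) Y = \<infinity>) \<longrightarrow>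
           ext_mutual_information P 2 (borel \<Otimes>\<^sub>M count_space UNIV) SN (\<lambda>\<omega>. (E \<omega>, M \<omega>)) Y\<^sub>N
           \<le> ext_mutual_information P 2 (borel \<Otimes>\<^sub>M count_space UNIV) borel (\<lambda>\<omega>. (E \<omega>, M \<omega>)) Z
             - ext_mutual_information P 2 (borel \<Otimes>\<^sub>M count_space UNIV) SY (\<lambda>\<omega>. (E \<omega>, M \<omega>)) Y) \<and>
           (ext_mutual_information P 2 (borel \<Otimes>\<^sub>M count_space UNIV) borel (\<lambda>\<omega>. (E \<omega>, M \<omega>)) Z
           \<le> ext_mutual_information P 2 borel borel E Z
             + ereal (prob_space.entropy P 2 (count_space UNIV) M)) \<and>
           (ext_mutual_information P 2 borel borel E Z
             + ereal (prob_space.entropy P 2 (count_space UNIV) M)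
           \<le> ext_mutual_information P 2 borel borel E Z
             + ereal (log 2 (real ((CARD('h) * CARD('w)) choose k))) + ereal (real k * real b))"
proof -
  interpret prob_space P by fact
  interpret information_space P 2 by standard simp
  let ?SU = "borel \<Otimes>\<^sub>M count_space UNIV :: ((real ^ 'd) \<times> (nat ^ 'w ^ 'h)) measure"
  let ?U = "\<lambda>\<omega>. (E \<omega>, M \<omega>)"
  note [measurable] = assms(6-11)
  have U: "?U \<in> measurable P ?SU" by measurable
  let ?IZ = "ext_mutual_information P 2 ?SU borel ?U Z"
  let ?IY = "ext_mutual_information P 2 ?SU SY ?U Y"
  let ?IN = "ext_mutual_information P 2 ?SU SN ?U Y\<^sub>N"
  have noise: "?IN \<le> ?IZ - ?IY" if ne: "\<not> (?IZ = \<infinity> \<and> ?IY = \<infinity>)"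
  proof (cases "?IZ = \<infinity>")
    case True
    \<comment> \<open>Here \<open>?IY\<close> is not \<infinity>, so the difference is
      \<infinity>.\<close>
    with ne show ?thesis by (cases ?IY) auto
  next
    case False
    then obtain f where f: "dependence_density P ?SU borel ?U Z f"
      using dependence_density_exists_of_finite_ext_mutual_information[OF U assms(9)] by blast
    note mi = ext_mutual_information_dependence_density[OF U assms(9) f, of 2]
    have int: "integrable P (\<lambda>\<omega>. log 2 (f (?U \<omega>, Z \<omega>)))"
      using False by (simp add: mi split: if_splits)
    \<comment> \<open>\<open>X\<close> belongs to \<open>?T\<close> because the last link of the
      chain is independence from \<open>(Y, Y\<^sub>N)\<close> and \<open>X\<close> jointly, given
      \<open>Z\<close>. The projections below recover \<open>Y\<close> and
      \<open>Y\<^sub>N\<close>.\<close>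
    let ?ST = "(SY \<Otimes>\<^sub>M SN) \<Otimes>\<^sub>M SX" and ?T = "\<lambda>\<omega>. ((Y \<omega>, Y\<^sub>N \<omega>), X \<omega>)"
    have ci: "cond_indep_rv P ?SU ?U ?ST ?T borel Z"
      using assms(15) by (simp add: markov_chain4_def)
    have V: "(\<lambda>\<omega>. (?T \<omega>, Z \<omega>)) \<in> measurable P (?ST \<Otimes>\<^sub>M borel)" by measurable
    have "\<exists>i j. ?IY = ereal i \<and> ?IN = ereal j \<and> i + j \<le> (\<integral>\<omega>. log 2 (f (?U \<omega>, Z \<omega>)) \<partial>P)"
      using ext_mutual_information_superadditive[OF U V dependence_density_markov[OF ci f], of 2
          "\<lambda>v. fst (fst (fst v))" SY "\<lambda>v. snd (fst (fst v))" SN]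
        int distr_pair_eq_of_indep_rv[OF assms(14)]
      by simp
    then show ?thesis using int by (auto simp: mi)
  qed
  define S where "S = {m :: nat ^ 'w ^ 'h. card {(i, j). m $ i $ j \<noteq> 0} \<le> k \<and> (\<forall>i j. m $ i $ j < 2 ^ b)}"
  have "\<alpha> * real (CARD('h) * CARD('w)) \<le> 1 * real (CARD('h) * CARD('w))"
    using assms(4) by (intro mult_right_mono) auto
  \<comment> \<open>This makes sets of exactly \<open>k\<close> positions available and the binomial
    coefficient positive, so that its logarithm can be split off.\<close>
  then have k: "k \<le> CARD('h) * CARD('w)"
    unfolding assms(5) by linarith
  have S: "AE \<omega> in P. M \<omega> \<in> S" "finite S"
  proof -
    show "AE \<omega> in P. M \<omega> \<in> S"
      using assms(12,13)
    proof eventually_elim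
      case (elim \<omega>)
      have "M \<omega> $ i $ j < 2 ^ b" for i j
      proof -
        have "M \<omega> $ i $ j \<le> 2 ^ b - 1" using elim(2) by simp
        moreover have "(0 :: nat) < 2 ^ b" by simp
        ultimately show ?thesis by linarith
      qed
      with elim(1) show ?case by (simp add: S_def)
    qed
    show "finite S" unfolding S_def using k by (rule finite_sparse_masks)
  qed
  have "entropy 2 (count_space UNIV) M \<le> log 2 (real (card S))"
    by (rule entropy_discrete_le_log_card[OF assms(11) S])
  also have "\<dots> \<le> log 2 (real ((CARD('h) * CARD('w) choose k) * (2 ^ b) ^ k))"
  proof (rule Transcendental.log_mono)
    \<comment> \<open>The zero mask shows that \<open>S\<close> is nonempty, as monotonicity of
      \<open>log\<close> requires.\<close>
    have "0 \<in> S" by (simp add: S_def)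
    with S(2) show "0 < real (card S)" by (auto simp: card_gt_0_iff)
    show "real (card S) \<le> real ((CARD('h) * CARD('w) choose k) * (2 ^ b) ^ k)"
      unfolding S_def using card_sparse_masks_le[OF k] by (intro of_nat_mono)
  qed simp
  also have "\<dots> = log 2 (real (CARD('h) * CARD('w) choose k)) + real k * real b"
    using k by (simp add: log_mult_pos log_nat_power zero_less_binomial_iff)
  finally have card: "ereal (entropy 2 (count_space UNIV) M) \<le>
      ereal (log 2 (real (CARD('h) * CARD('w) choose k))) + ereal (real k * real b)"
    by simp
  show ?thesis
    using noise ext_mutual_information_pair_discrete_le[OF _ assms(10,9,11) S, of 2] add_left_mono[OF card]
    by (auto simp: add.assoc)
qed

end
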